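(* Let $X$ be a (reduced) plane curve and let $X'$ denote its weak normalization. If $\mathcal{O}_{X'} = \omega_X^0$, then $X$ is smooth.
   Context: For a reduced curve $X$ in a smooth complex surface $P$ (the plane), $\Omega^k$ is the sheaf of holomorphic $k$-forms on $P$, $\Omega^k(\ell X)$ the sheaf of meromorphic $k$-forms with poles of order at most $\ell$ along $X$, $\Omega^k(X)=\Omega^k(1X)$, $\Omega^1(\log X)=\ker\left(d:\Omega^1(X)\to\Omega^{2}(2X)/\Omega^{2}(X)\right)$ and $\omega_X^0=\Omega^1(\log X)/\Omega^1$. The weak normalization $X'$ of $X$ is the complex space over $X$, homeomorphic to $X$, such that the sections of $\mathcal{O}_{X'}$ over an open set of $X$ are the continuous functions whose restriction to the regular locus of $X$ is holomorphic. Thus $\mathcal{O}_X\subset\mathcal{O}_{X'}\subset\tilde{\mathcal{O}}_X$, where $\tilde{\mathcal{O}}_X$ is the structure sheaf of the normalization. There is a natural injection $\tilde{\mathcal{O}}_X\to\omega_X^0$ extending the inverse of the residue isomorphism $\omega^0_X\simeq\mathcal{O}_X$ on the regular locus (sending $1$ to the class of $df/f$, $f$ a local equation); the equality $\mathcal{O}_{X'}=\omega_X^0$ is understood with respect to this injection. *)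

theory Defs
  imports "HOL-Complex_Analysis.Complex_Analysis"
begin

section \<open>Holomorphic functions of two variables\<close>

text \<open>Complex differentiability: the total derivative exists and is complex-linear.
  This is only used on open sets.\<close>

definition hol2 :: "(complex \<times> complex) set \<Rightarrow> (complex \<times> complex \<Rightarrow> complex) \<Rightarrow> bool" where
  "hol2 U f \<longleftrightarrow>
     (\<forall>z\<in>U. \<exists>a b. (f has_derivative (\<lambda>v. a * fst v + b * snd v)) (at z))"

definition pd1 :: "(complex \<times> complex \<Rightarrow> complex) \<Rightarrow> complex \<times> complex \<Rightarrow> complex" where
  "pd1 f z = deriv (\<lambda>t. f (t, snd z)) (fst z)"

definition pd2 :: "(complex \<times> complex \<Rightarrow> complex) \<Rightarrow> complex \<times> complex \<Rightarrow> complex" where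
  "pd2 f z = deriv (\<lambda>t. f (fst z, t)) (snd z)"


section \<open>Reduced curves in open subsets of the affine plane\<close>

text \<open>\<open>f\<close> generates, over every open subset of \<open>U\<close>, the ideal of the holomorphic functions
  vanishing on \<open>Y\<close>; thus \<open>Y\<close> carries its reduced structure.\<close>

definition local_equation ::
  "(complex \<times> complex) set \<Rightarrow> (complex \<times> complex) set \<Rightarrow> (complex \<times> complex \<Rightarrow> complex) \<Rightarrow> bool" where
  "local_equation Y U f \<longleftrightarrow>
     open U \<and> hol2 U f \<and> Y \<inter> U = {z\<in>U. f z = 0} \<and>
     (\<forall>V g. open V \<and> V \<subseteq> U \<and> hol2 V g \<and> (\<forall>z\<in>Y \<inter> V. g z = 0) \<longrightarrow>
        (\<exists>h. hol2 V h \<and> (\<forall>z\<in>V. g z = f z * h z)))"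

text \<open>Equations are required at all points of \<open>G\<close>, so that \<open>Y\<close> is closed in \<open>G\<close>.
  Empty interior says that the local equations are not identically zero near any point.\<close>

definition plane_curve :: "(complex \<times> complex) set \<Rightarrow> (complex \<times> complex) set \<Rightarrow> bool" where
  "plane_curve G Y \<longleftrightarrow>
     Y \<subseteq> G \<and> interior Y = {} \<and> (\<forall>p\<in>G. \<exists>U f. p \<in> U \<and> U \<subseteq> G \<and> local_equation Y U f)"

text \<open>The points near which \<open>Y\<close> is a one-dimensional complex submanifold.\<close>

definition regular_locus :: "(complex \<times> complex) set \<Rightarrow> (complex \<times> complex) set" where
  "regular_locus Y =
     {p\<in>Y. \<exists>U f. open U \<and> p \<in> U \<and> hol2 U f \<and> Y \<inter> U = {z\<in>U. f z = 0} \<and>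
                  (pd1 f p \<noteq> 0 \<or> pd2 f p \<noteq> 0)}"


section \<open>Meromorphic and logarithmic forms\<close>

text \<open>A 1-form \<open>a dx + b dy\<close> is the function \<open>z \<mapsto> (a z, b z)\<close>, a 2-form \<open>c dx \<and> dy\<close> is the
  function \<open>c\<close>. Forms with poles along \<open>Y\<close> are forms on the complement of \<open>Y\<close>; the values
  that the representing total functions take on \<open>Y\<close> are irrelevant.\<close>

type_synonym form1 = "complex \<times> complex \<Rightarrow> complex \<times> complex"
type_synonym form2 = "complex \<times> complex \<Rightarrow> complex"

text \<open>Poles of order at most \<open>l\<close> along \<open>Y\<close>. For \<open>l = 0\<close> these are the functions
  that extend holomorphically to \<open>U\<close>.\<close>

definition mero :: "nat \<Rightarrow> (complex \<times> complex) set \<Rightarrow> (complex \<times> complex) set \<Rightarrow>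
    (complex \<times> complex \<Rightarrow> complex) \<Rightarrow> bool" where
  "mero l Y U a \<longleftrightarrow>
     hol2 (U - Y) a \<and>
     (\<forall>p\<in>U. \<exists>V f h. p \<in> V \<and> V \<subseteq> U \<and> local_equation Y V f \<and> hol2 V h \<and>
                     (\<forall>z\<in>V - Y. f z ^ l * a z = h z))"

definition Omega1 :: "nat \<Rightarrow> (complex \<times> complex) set \<Rightarrow> (complex \<times> complex) set \<Rightarrow> form1 set" where
  "Omega1 l Y U = {\<omega>. mero l Y U (\<lambda>z. fst (\<omega> z)) \<and> mero l Y U (\<lambda>z. snd (\<omega> z))}"

definition Omega2 :: "nat \<Rightarrow> (complex \<times> complex) set \<Rightarrow> (complex \<times> complex) set \<Rightarrow> form2 set" where
  "Omega2 l Y U = {\<eta>. mero l Y U \<eta>}"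

definition d0 :: "(complex \<times> complex \<Rightarrow> complex) \<Rightarrow> form1" where
  "d0 f = (\<lambda>z. (pd1 f z, pd2 f z))"

definition d1 :: "form1 \<Rightarrow> form2" where
  "d1 \<omega> = (\<lambda>z. pd1 (\<lambda>w. snd (\<omega> w)) z - pd2 (\<lambda>w. fst (\<omega> w)) z)"

definition Omega1_log :: "(complex \<times> complex) set \<Rightarrow> (complex \<times> complex) set \<Rightarrow> form1 set" where
  "Omega1_log Y U = {\<omega> \<in> Omega1 1 Y U. d1 \<omega> \<in> Omega2 1 Y U}"

text \<open>The stalk at \<open>p\<close> of the quotient sheaf of logarithmic by holomorphic 1-forms.\<close>

definition log_germs ::
  "(complex \<times> complex) set \<Rightarrow> (complex \<times> complex) set \<Rightarrow> complex \<times> complex \<Rightarrow>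
     ((complex \<times> complex) set \<times> form1) set" where
  "log_germs G Y p = {(U, \<omega>). open U \<and> p \<in> U \<and> U \<subseteq> G \<and> \<omega> \<in> Omega1_log Y U}"

definition log_rel ::
  "(complex \<times> complex) set \<Rightarrow> (complex \<times> complex) set \<Rightarrow> complex \<times> complex \<Rightarrow>
     (((complex \<times> complex) set \<times> form1) \<times> ((complex \<times> complex) set \<times> form1)) set" where
  "log_rel G Y p =
     {((U, \<omega>), (V, \<eta>)). (U, \<omega>) \<in> log_germs G Y p \<and> (V, \<eta>) \<in> log_germs G Y p \<and>
        (\<exists>W. open W \<and> p \<in> W \<and> W \<subseteq> U \<inter> V \<and> (\<lambda>z. \<omega> z - \<eta> z) \<in> Omega1 0 Y W)}"

definition omega0_stalk ::
  "(complex \<times> complex) set \<Rightarrow> (complex \<times> complex) set \<Rightarrow> complex \<times> complex \<Rightarrow>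
     ((complex \<times> complex) set \<times> form1) set set" where
  "omega0_stalk G Y p = log_germs G Y p // log_rel G Y p"


section \<open>The weak normalization and its embedding\<close>

text \<open>Sections over \<open>Y \<inter> U\<close> of the structure sheaf of the weak normalization. Holomorphic on the
  regular locus means: locally the restriction of a holomorphic function of two variables.\<close>

definition weak_norm_sections ::
  "(complex \<times> complex) set \<Rightarrow> (complex \<times> complex) set \<Rightarrow> (complex \<times> complex \<Rightarrow> complex) set" where
  "weak_norm_sections Y U =
     {\<phi>. continuous_on (Y \<inter> U) \<phi> \<and>
         (\<forall>q\<in>regular_locus Y \<inter> U. \<exists>V g. open V \<and> q \<in> V \<and> V \<subseteq> U \<and> hol2 V g \<and>
             (\<forall>z\<in>Y \<inter> V. g z = \<phi> z))}"

definition weak_norm_germs ::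
  "(complex \<times> complex) set \<Rightarrow> (complex \<times> complex) set \<Rightarrow> complex \<times> complex \<Rightarrow>
     ((complex \<times> complex) set \<times> (complex \<times> complex \<Rightarrow> complex)) set" where
  "weak_norm_germs G Y p = {(U, \<phi>). open U \<and> p \<in> U \<and> U \<subseteq> G \<and> \<phi> \<in> weak_norm_sections Y U}"

text \<open>The logarithmic form \<open>\<omega>\<close> has, on the regular locus in \<open>W\<close>, the class of \<open>\<phi> df/f\<close>:
  near each regular point \<open>\<omega> - g df/f\<close> is holomorphic for a local equation \<open>f\<close> and a
  holomorphic extension \<open>g\<close> of \<open>\<phi>\<close>.\<close>

definition has_residue ::
  "(complex \<times> complex) set \<Rightarrow> (complex \<times> complex) set \<Rightarrow> form1 \<Rightarrow>
     (complex \<times> complex \<Rightarrow> complex) \<Rightarrow> bool" where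
  "has_residue Y W \<omega> \<phi> \<longleftrightarrow>
     (\<forall>q\<in>regular_locus Y \<inter> W. \<exists>N f g. q \<in> N \<and> N \<subseteq> W \<and> local_equation Y N f \<and> hol2 N g \<and>
        (\<forall>z\<in>Y \<inter> N. g z = \<phi> z) \<and>
        (\<lambda>z. (fst (\<omega> z) - g z * (fst (d0 f z) / f z),
              snd (\<omega> z) - g z * (snd (d0 f z) / f z))) \<in> Omega1 0 Y N)"

text \<open>The image of the germ of \<open>\<phi>\<close> under the natural injection. A logarithmic form that is
  holomorphic at the regular points of \<open>Y\<close> is holomorphic, so the representatives below
  form a single class.\<close>

fun residue_inj ::
  "(complex \<times> complex) set \<Rightarrow> (complex \<times> complex) set \<Rightarrow> complex \<times> complex \<Rightarrow>
     (complex \<times> complex) set \<times> (complex \<times> complex \<Rightarrow> complex) \<Rightarrow>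
     ((complex \<times> complex) set \<times> form1) set" where
  "residue_inj G Y p (U, \<phi>) =
     {(V, \<omega>) \<in> log_germs G Y p.
        \<exists>W. open W \<and> p \<in> W \<and> W \<subseteq> U \<inter> V \<and> has_residue Y W \<omega> \<phi>}"

definition plane_weak_norm_eq_omega0 ::
  "(complex \<times> complex) set \<Rightarrow> (complex \<times> complex) set \<Rightarrow> bool" where
  "plane_weak_norm_eq_omega0 G Y \<longleftrightarrow>
     (\<forall>p\<in>Y. residue_inj G Y p ` weak_norm_germs G Y p = omega0_stalk G Y p)"


section \<open>Curves in a smooth complex surface\<close>

type_synonym 'a chart = "'a set \<times> ('a \<Rightarrow> complex \<times> complex)"

definition complex_surface :: "'a::t2_space set \<Rightarrow> 'a chart set \<Rightarrow> bool" where
  "complex_surface P A \<longleftrightarrow>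
     P = \<Union> (fst ` A) \<and>
     (\<forall>(D, \<phi>)\<in>A. open D \<and> open (\<phi> ` D) \<and> homeomorphism D (\<phi> ` D) \<phi> (inv_into D \<phi>)) \<and>
     (\<forall>(D, \<phi>)\<in>A. \<forall>(E, \<psi>)\<in>A.
        hol2 (\<psi> ` (D \<inter> E)) (\<lambda>z. fst (\<phi> (inv_into E \<psi> z))) \<and>
        hol2 (\<psi> ` (D \<inter> E)) (\<lambda>z. snd (\<phi> (inv_into E \<psi> z))))"

text \<open>The following notions are local on the surface and invariant under biholomorphic
  changes of coordinates; they are expressed in the charts of the atlas.\<close>

definition reduced_curve :: "'a::t2_space set \<Rightarrow> 'a chart set \<Rightarrow> 'a set \<Rightarrow> bool" where
  "reduced_curve P A X \<longleftrightarrow> X \<subseteq> P \<and> (\<forall>(D, \<phi>)\<in>A. plane_curve (\<phi> ` D) (\<phi> ` (X \<inter> D)))"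

definition weak_norm_eq_omega0 :: "'a::t2_space chart set \<Rightarrow> 'a set \<Rightarrow> bool" where
  "weak_norm_eq_omega0 A X \<longleftrightarrow>
     (\<forall>(D, \<phi>)\<in>A. plane_weak_norm_eq_omega0 (\<phi> ` D) (\<phi> ` (X \<inter> D)))"

definition smooth_curve :: "'a::t2_space chart set \<Rightarrow> 'a set \<Rightarrow> bool" where
  "smooth_curve A X \<longleftrightarrow> (\<forall>(D, \<phi>)\<in>A. regular_locus (\<phi> ` (X \<inter> D)) = \<phi> ` (X \<inter> D))"

end

theory Submission
  imports Defs
begin

text \<open>The hypothesis makes the residue of every logarithmic form continuous along the curve. At a
singular point one could write down a logarithmic form whose residue is not continuous.

Let \<open>p\<close> be a point of the curve \<open>Y\<close>. In linear coordinates whose second axis is not tangent to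
\<open>Y\<close>, the points of \<open>Y\<close> over a small \<open>x\<close> are the roots \<open>y\<^sub>1, \<dots>, y\<^sub>n\<close> of a monic polynomial \<open>W\<close> with
holomorphic coefficients, and \<open>\<bar>y\<^sub>i\<bar> \<le> K \<bar>x\<bar>\<close>. Measured from their mean \<open>m(x)\<close> the roots sum up to
zero, so with \<open>H = y - m(x)\<close> the polynomial is
\<open>W = H\<^sup>n + c\<^sub>2(x) H\<^sup>n\<^sup>-\<^sup>2 + \<dots> + c\<^sub>n(x)\<close>. As \<open>Y\<close> is reduced, \<open>W\<close> is again a local equation.

Suppose that every \<open>c\<^sub>k\<close> is divisible by \<open>x\<^sup>N\<^sup>+\<^sup>1\<close>, where \<open>N \<ge> 1\<close>; for \<open>N = 1\<close> this is the bound
\<open>\<bar>c\<^sub>k\<bar> \<le> C \<bar>x\<bar>\<^sup>k\<close>, \<open>k \<ge> 2\<close>. Then the form \<open>\<Sum>\<^sub>i (H\<^sub>i / x\<^sup>N) d(y - y\<^sub>i) / (y - y\<^sub>i)\<close>, with \<open>H\<^sub>i = y\<^sub>i - m\<close>, is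
logarithmic: written in terms of \<open>c\<^sub>k\<close> and \<open>dc\<^sub>k\<close> its numerators are visibly divisible by \<open>x\<^sup>N\<close>
(\<open>polar_logarithmic_form\<close>). Its residue is \<open>H / x\<^sup>N\<close>, at first on the nonsingular points, which
are dense (\<open>nonsingular_points_dense\<close>). By hypothesis the residue is continuous at \<open>p\<close>, with
value \<open>\<lambda>\<close>, say; so all \<open>H\<^sub>i / x\<^sup>N\<close> tend to \<open>\<lambda>\<close>. Their sum is zero, hence \<open>\<lambda> = 0\<close>
(\<open>roots_small_order\<close>). Therefore \<open>H\<^sub>i = o(x\<^sup>N)\<close>, and \<open>c\<^sub>k = o(x\<^sup>2\<^sup>N)\<close> is divisible by \<open>x\<^sup>N\<^sup>+\<^sup>2\<close>.

By induction all \<open>c\<^sub>k\<close> are divisible by all powers of \<open>x\<close>, so they vanish and \<open>W = H\<^sup>n\<close>. Near \<open>p\<close>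
the curve is the zero set of \<open>H\<close>, whose differential does not vanish.\<close>


section \<open>Holomorphic functions of two variables\<close>

text \<open>By Cauchy's formula the derivative is an integral over a fixed circle, and the integrand is
jointly continuous.\<close>

lemma deriv_continuous_on_param:
  fixes f :: "complex \<Rightarrow> 'b::metric_space \<Rightarrow> complex"
  assumes "open S" and cont: "continuous_on (S \<times> T) (\<lambda>(x, t). f x t)"
    and hol: "\<And>t. t \<in> T \<Longrightarrow> (\<lambda>x. f x t) holomorphic_on S"
  shows "continuous_on (S \<times> T) (\<lambda>(x, t). deriv (\<lambda>x. f x t) x)"
proof -
  have local: "continuous_on (ball x0 r \<times> T) (\<lambda>(x, t). deriv (\<lambda>x. f x t) x)"
    if r: "0 < r" "cball x0 r \<subseteq> S" for x0 r
  proof -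
    let ?g = "circlepath x0 r"
    let ?I = "\<lambda>p s. f (?g s) (snd p) / (?g s - fst p)^2 * (2 * pi * \<i> * r * exp (2 * of_real pi * \<i> * s))"
    have circ: "?g s \<in> sphere x0 r" if "s \<in> {0..1}" for s
      using r path_image_circlepath_nonneg[of r x0] that by (auto simp: path_image_def)
    have contg: "continuous_on {0..1} ?g"
      using path_circlepath[of x0 r] by (simp add: path_def)
    have c1: "continuous_on ((ball x0 r \<times> T) \<times> {0..1}) (\<lambda>q. f (?g (snd q)) (snd (fst q)))"
    proof -
      have "continuous_on ((ball x0 r \<times> T) \<times> {0..1}) (\<lambda>q. (?g (snd q), snd (fst q)))"
        by (intro continuous_on_Pair continuous_on_compose2[OF contg] continuous_intros) auto
      moreover have "(\<lambda>q. (?g (snd q), snd (fst q))) ` ((ball x0 r \<times> T) \<times> {0..1}) \<subseteq> S \<times> T"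
      proof (rule image_subsetI)
        fix q :: "(complex \<times> 'b) \<times> real" assume q: "q \<in> (ball x0 r \<times> T) \<times> {0..1}"
        then have "?g (snd q) \<in> sphere x0 r" using circ by (auto simp del: mem_sphere)
        then show "(?g (snd q), snd (fst q)) \<in> S \<times> T" using q r by auto
      qed
      ultimately show ?thesis
        using continuous_on_compose2[OF cont, of "(ball x0 r \<times> T) \<times> {0..1}" "\<lambda>q. (?g (snd q), snd (fst q))"]
        by (simp add: case_prod_beta)
    qed
    have ne: "?g (snd q) - fst (fst q) \<noteq> 0" if "q \<in> (ball x0 r \<times> T) \<times> {0..1}" for q
    proof -
      have "?g (snd q) \<in> sphere x0 r" using circ that by (auto simp del: mem_sphere)
      then show ?thesis using that by auto
    qed
    have "continuous_on ((ball x0 r \<times> T) \<times> {0..1}) (\<lambda>q. ?I (fst q) (snd q))"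
      by (intro continuous_intros c1 continuous_on_compose2[OF contg]) (use ne in auto)
    then have "continuous_on (ball x0 r \<times> T) (\<lambda>p. integral (cbox 0 1) (?I p))"
      by (intro integral_continuous_on_param) (simp add: case_prod_beta)
    then have "continuous_on (ball x0 r \<times> T) (\<lambda>p. 1 / (2 * pi * \<i>) * integral (cbox 0 1) (?I p))"
      by (intro continuous_intros)
    then show ?thesis
    proof (rule continuous_on_eq)
      fix p assume p: "p \<in> ball x0 r \<times> T"
      have "(\<lambda>x. f x (snd p)) holomorphic_on S" using p hol by auto
      then have h: "(\<lambda>x. f x (snd p)) holomorphic_on cball x0 r"
        "(\<lambda>x. f x (snd p)) holomorphic_on ball x0 r"
        using r ball_subset_cball[of x0 r] by (blast intro: holomorphic_on_subset)+
      have "((\<lambda>x. f x (snd p)) has_field_derivative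
           1 / (2 * of_real pi * \<i>) * contour_integral ?g (\<lambda>u. f u (snd p) / (u - fst p)^2)) (at (fst p))"
        by (rule Cauchy_derivative_integral_circlepath)
          (use p h in \<open>auto intro: holomorphic_on_imp_continuous_on\<close>)
      then show "1 / (2 * pi * \<i>) * integral (cbox 0 1) (?I p)
          = (case p of (x, t) \<Rightarrow> deriv (\<lambda>x. f x t) x)"
        by (simp add: DERIV_imp_deriv case_prod_beta contour_integral_integral
            vector_derivative_circlepath)
    qed
  qed
  show ?thesis
    unfolding continuous_on_eq_continuous_within
  proof
    fix p assume p: "p \<in> S \<times> T"
    then obtain r where r: "0 < r" "cball (fst p) r \<subseteq> S"
      using \<open>open S\<close> open_contains_cball by (metis mem_Times_iff)
    have "at p within S \<times> T = at p within ball (fst p) r \<times> T"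
      by (rule at_within_nhd[of _ "ball (fst p) r \<times> UNIV"])
        (use p r in \<open>auto intro: open_Times\<close>)
    moreover have "p \<in> ball (fst p) r \<times> T" using p r by (auto simp: mem_Times_iff)
    ultimately show "continuous (at p within S \<times> T) (\<lambda>(x, t). deriv (\<lambda>x. f x t) x)"
      using local[OF r] unfolding continuous_on_eq_continuous_within by metis
  qed
qed

lemma holomorphic_circle_integral:
  assumes "open S" "convex S" "0 < r"
    and cont: "continuous_on (S \<times> sphere z r) (\<lambda>(x, w). H x w)"
    and hol: "\<And>w. w \<in> sphere z r \<Longrightarrow> (\<lambda>x. H x w) holomorphic_on S"
  shows "(\<lambda>x. contour_integral (circlepath z r) (H x)) holomorphic_on S"
proof -
  let ?g = "circlepath z r"
  let ?d = "\<lambda>s::real. 2 * pi * \<i> * r * exp (2 * of_real pi * \<i> * s)"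
  have circ: "?g s \<in> sphere z r" if "s \<in> {0..1}" for s
    using assms(3) path_image_circlepath_nonneg[of r z] that by (auto simp: path_image_def)
  have contg: "continuous_on {0..1} ?g"
    using path_circlepath[of z r] by (simp add: path_def)
  have K: "continuous_on (S \<times> {0..1}) (\<lambda>(x, s). H x (?g s))"
  proof -
    have "continuous_on (S \<times> {0..1}) (\<lambda>q. (fst q, ?g (snd q)))"
      by (intro continuous_on_Pair continuous_on_compose2[OF contg] continuous_intros) auto
    moreover have "(\<lambda>q. (fst q, ?g (snd q))) ` (S \<times> {0..1}) \<subseteq> S \<times> sphere z r"
      using circ by (auto simp del: mem_sphere)
    ultimately show ?thesis
      using continuous_on_compose2[OF cont, of "S \<times> {0..1}" "\<lambda>q. (fst q, ?g (snd q))"]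
      by (simp add: case_prod_beta)
  qed
  have D: "continuous_on (S \<times> {0..1}) (\<lambda>(x, s). deriv (\<lambda>x. H x (?g s)) x)"
    using deriv_continuous_on_param[OF assms(1) K] hol[OF circ] by simp
  have "(\<lambda>x. integral (cbox 0 1) (\<lambda>s. H x (?g s) * ?d s)) holomorphic_on S"
  proof (rule leibniz_rule_holomorphic[where fx = "\<lambda>x s. deriv (\<lambda>x. H x (?g s)) x * ?d s"])
    fix x and s :: real assume xs: "x \<in> S" "s \<in> cbox 0 1"
    then have "(\<lambda>x. H x (?g s)) holomorphic_on S" using hol[OF circ[of s]] by simp
    then have "((\<lambda>x. H x (?g s)) has_field_derivative deriv (\<lambda>x. H x (?g s)) x) (at x)"
      using holomorphic_derivI assms(1) xs by blast
    then show "((\<lambda>x. H x (?g s) * ?d s) has_field_derivative deriv (\<lambda>x. H x (?g s)) x * ?d s)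
        (at x within S)"
      by (rule DERIV_cmult_right[OF has_field_derivative_at_within])
  next
    fix x assume x: "x \<in> S"
    have "continuous_on {0..1} (\<lambda>s. H x (?g s))"
      using continuous_on_compose2[OF K, of "{0..1}" "\<lambda>s. (x, s)"] x
      by (simp add: image_subset_iff continuous_on_Pair)
    then show "(\<lambda>s. H x (?g s) * ?d s) integrable_on cbox 0 1"
      by (intro integrable_continuous continuous_intros) auto
  next
    show "continuous_on (S \<times> cbox 0 1) (\<lambda>(x, s). deriv (\<lambda>x. H x (?g s)) x * ?d s)"
      using D unfolding case_prod_beta by (intro continuous_intros) auto
  qed (use assms in auto)
  then show ?thesis
    by (simp add: contour_integral_integral vector_derivative_circlepath)
qed

lemma pd_eqI:
  assumes "(f has_derivative (\<lambda>v. a * fst v + b * snd v)) (at z)"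
  shows "pd1 f z = a" "pd2 f z = b"
    "((\<lambda>t. f (t, snd z)) has_field_derivative a) (at (fst z))"
    "((\<lambda>t. f (fst z, t)) has_field_derivative b) (at (snd z))"
proof -
  have f: "(f has_derivative (\<lambda>v. a * fst v + b * snd v)) (at (fst z, snd z))" using assms by simp
  have "((\<lambda>t. (t, snd z)) has_derivative (\<lambda>h. (h, 0))) (at (fst z))"
    by (auto intro!: derivative_eq_intros)
  from has_derivative_compose[OF this f]
  show 1: "((\<lambda>t. f (t, snd z)) has_field_derivative a) (at (fst z))"
    by (simp add: has_field_derivative_def)
  have "((\<lambda>t. (fst z, t)) has_derivative (\<lambda>h. (0, h))) (at (snd z))"
    by (auto intro!: derivative_eq_intros)
  from has_derivative_compose[OF this f]
  show 2: "((\<lambda>t. f (fst z, t)) has_field_derivative b) (at (snd z))"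
    by (simp add: has_field_derivative_def)
  show "pd1 f z = a" "pd2 f z = b"
    unfolding pd1_def pd2_def using 1 2 by (auto intro: DERIV_imp_deriv)
qed

lemma hol2_has_derivative:
  assumes "hol2 U f" "z \<in> U"
  shows "(f has_derivative (\<lambda>v. pd1 f z * fst v + pd2 f z * snd v)) (at z)"
proof -
  obtain a b where "(f has_derivative (\<lambda>v. a * fst v + b * snd v)) (at z)"
    using assms unfolding hol2_def by blast
  with pd_eqI(1,2)[OF this] show ?thesis by simp
qed

lemma hol2_continuous_on:
  assumes "hol2 U f"
  shows "continuous_on U f"
  by (rule continuous_at_imp_continuous_on)
    (rule ballI has_derivative_continuous hol2_has_derivative[OF assms])+

lemma hol2_subset: "hol2 U f \<Longrightarrow> V \<subseteq> U \<Longrightarrow> hol2 V f"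
  by (auto simp: hol2_def)

lemma hol2_pd_fields:
  assumes "hol2 U f" "(x, y) \<in> U"
  shows "((\<lambda>t. f (t, y)) has_field_derivative pd1 f (x, y)) (at x)"
    "((\<lambda>t. f (x, t)) has_field_derivative pd2 f (x, y)) (at y)"
  using pd_eqI(3,4)[OF hol2_has_derivative[OF assms]] by auto

lemma hol2_cong:
  assumes "open U" "hol2 U f" "\<And>z. z \<in> U \<Longrightarrow> f z = g z"
  shows "hol2 U g"
  unfolding hol2_def
proof
  fix z assume z: "z \<in> U"
  have "(g has_derivative (\<lambda>v. pd1 f z * fst v + pd2 f z * snd v)) (at z)"
    by (rule has_derivative_transform_within_open[OF hol2_has_derivative[OF assms(2) z] assms(1) z])
      (use assms(3) in auto)
  then show "\<exists>a b. (g has_derivative (\<lambda>v. a * fst v + b * snd v)) (at z)" by (intro exI)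
qed

lemma hol2_local:
  assumes "\<And>z. z \<in> U \<Longrightarrow> \<exists>V. open V \<and> z \<in> V \<and> hol2 V f"
  shows "hol2 U f"
  unfolding hol2_def
proof
  fix z assume "z \<in> U"
  then obtain V where "z \<in> V" "hol2 V f" using assms by metis
  then show "\<exists>a b. (f has_derivative (\<lambda>v. a * fst v + b * snd v)) (at z)"
    unfolding hol2_def by simp
qed

text \<open>Osgood's lemma for functions that are known to be continuous: one partial derivative is jointly
continuous by \<open>deriv_continuous_on_param\<close>, which makes separate differentiability total.\<close>

lemma hol2I_separately_differentiable:
  assumes U: "open U" and cont: "continuous_on U f"
    and h1: "\<And>x y. (x, y) \<in> U \<Longrightarrow> (\<lambda>t. f (t, y)) field_differentiable at x"
    and h2: "\<And>x y. (x, y) \<in> U \<Longrightarrow> (\<lambda>t. f (x, t)) field_differentiable at y"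
  shows "hol2 U f"
  unfolding hol2_def
proof
  fix z assume "z \<in> U"
  obtain x y where z: "z = (x, y)" by (cases z)
  then obtain A B where AB: "open A" "open B" "x \<in> A" "y \<in> B" "A \<times> B \<subseteq> U"
    using open_prod_elim[OF U \<open>z \<in> U\<close>] by (metis mem_Sigma_iff)
  obtain s where s: "0 < s" "ball y s \<subseteq> B" using AB open_contains_ball by blast
  have sub: "A \<times> ball y s \<subseteq> U" using AB s by auto
  have D: "continuous_on (ball y s \<times> A) (\<lambda>(t, u). deriv (\<lambda>t. f (u, t)) t)"
  proof (rule deriv_continuous_on_param)
    show "continuous_on (ball y s \<times> A) (\<lambda>(x, t). f (t, x))"
      unfolding case_prod_beta
      by (rule continuous_on_compose2[OF cont]) (use sub in \<open>auto intro!: continuous_intros\<close>)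
    show "(\<lambda>x. f (t, x)) holomorphic_on ball y s" if "t \<in> A" for t
      unfolding holomorphic_on_def
    proof
      fix u assume "u \<in> ball y s"
      then have "(t, u) \<in> U" using sub that by blast
      then show "(\<lambda>x. f (t, x)) field_differentiable at u within ball y s"
        by (rule field_differentiable_at_within[OF h2])
    qed
  qed auto
  have D': "continuous_on (A \<times> ball y s) (\<lambda>q. deriv (\<lambda>t. f (fst q, t)) (snd q))"
    using continuous_on_compose2[OF D, of "A \<times> ball y s" "\<lambda>q. (snd q, fst q)"]
    by (simp add: case_prod_beta image_subset_iff continuous_on_Pair continuous_on_fst continuous_on_snd)
  have "((\<lambda>(u, t). f (u, t)) has_derivative (\<lambda>(tx, ty). deriv (\<lambda>t. f (t, y)) x * tx
      + blinfun_apply (blinfun_mult_right (deriv (\<lambda>t. f (x, t)) y)) ty)) (at (x, y) within A \<times> ball y s)"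
  proof (rule has_derivative_partialsI[where fy = "\<lambda>u t. blinfun_mult_right (deriv (\<lambda>t. f (u, t)) t)"])
    show "((\<lambda>x. f (x, y)) has_derivative (*) (deriv (\<lambda>t. f (t, y)) x)) (at x within A)"
    proof -
      have "((\<lambda>t. f (t, y)) has_field_derivative deriv (\<lambda>t. f (t, y)) x) (at x)"
        using h1[of x y] \<open>z \<in> U\<close> z by (simp add: DERIV_deriv_iff_field_differentiable)
      from has_field_derivative_at_within[OF this, of A] show ?thesis
        by (simp add: has_field_derivative_def)
    qed
    show "((\<lambda>t. f (u, t)) has_derivative blinfun_apply (blinfun_mult_right (deriv (\<lambda>t. f (u, t)) t)))
        (at t within ball y s)" if "u \<in> A" "t \<in> ball y s" for u t
    proof -
      have "(u, t) \<in> U" using sub that by blast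
      then have "((\<lambda>t. f (u, t)) has_field_derivative deriv (\<lambda>t. f (u, t)) t) (at t)"
        using h2[of u t] by (simp add: DERIV_deriv_iff_field_differentiable)
      from has_field_derivative_at_within[OF this, of "ball y s"] show ?thesis
        by (simp add: has_field_derivative_def)
    qed
    have "((\<lambda>q. deriv (\<lambda>t. f (fst q, t)) (snd q)) \<longlongrightarrow> deriv (\<lambda>t. f (x, t)) y)
        (at (x, y) within A \<times> ball y s)"
      using bspec[OF D'[unfolded continuous_on_def], of "(x, y)"] AB s by simp
    from bounded_linear.tendsto[OF bounded_linear_blinfun_mult_right this]
    show "continuous (at (x, y) within A \<times> ball y s)
        (\<lambda>(u, t). blinfun_mult_right (deriv (\<lambda>t. f (u, t)) t))"
      by (simp add: continuous_within case_prod_unfold)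
  qed (use s in auto)
  moreover have "at (x, y) within A \<times> ball y s = at (x, y)"
    using AB s by (intro at_within_open open_Times) auto
  ultimately have "(f has_derivative
      (\<lambda>v. deriv (\<lambda>t. f (t, y)) x * fst v + deriv (\<lambda>t. f (x, t)) y * snd v)) (at z)"
    by (simp add: z case_prod_unfold)
  then show "\<exists>a b. (f has_derivative (\<lambda>v. a * fst v + b * snd v)) (at z)" by (intro exI)
qed

lemma hol2I_holomorphic:
  assumes "open U" "continuous_on U f"
    and "\<And>x y. (x, y) \<in> U \<Longrightarrow> \<exists>S. open S \<and> x \<in> S \<and> (\<lambda>t. f (t, y)) holomorphic_on S"
    and "\<And>x y. (x, y) \<in> U \<Longrightarrow> \<exists>S. open S \<and> y \<in> S \<and> (\<lambda>t. f (x, t)) holomorphic_on S"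
  shows "hol2 U f"
  by (rule hol2I_separately_differentiable) (use assms in \<open>meson holomorphic_on_imp_differentiable_at\<close>)+

lemma hol2_swap:
  assumes "hol2 U f"
  shows "hol2 (prod.swap ` U) (\<lambda>z. f (prod.swap z))"
    "\<And>z. z \<in> U \<Longrightarrow> pd1 (\<lambda>z. f (prod.swap z)) (prod.swap z) = pd2 f z"
proof -
  have *: "((\<lambda>z. f (prod.swap z)) has_derivative (\<lambda>v. pd2 f z * fst v + pd1 f z * snd v))
      (at (prod.swap z))" if "z \<in> U" for z
  proof -
    have s: "(prod.swap has_derivative prod.swap) (at (prod.swap z))"
      unfolding prod.swap_def by (auto intro!: derivative_eq_intros)
    have "(f has_derivative (\<lambda>v. pd1 f z * fst v + pd2 f z * snd v)) (at (prod.swap (prod.swap z)))"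
      using hol2_has_derivative[OF assms that] by simp
    from has_derivative_compose[OF s this] show ?thesis by (simp add: add.commute)
  qed
  show "hol2 (prod.swap ` U) (\<lambda>z. f (prod.swap z))"
    unfolding hol2_def
  proof
    fix w assume "w \<in> prod.swap ` U"
    then obtain z where "z \<in> U" "w = prod.swap z" by auto
    with *[of z] show "\<exists>a b. ((\<lambda>z. f (prod.swap z)) has_derivative (\<lambda>v. a * fst v + b * snd v)) (at w)"
      by blast
  qed
  show "pd1 (\<lambda>z. f (prod.swap z)) (prod.swap z) = pd2 f z" if "z \<in> U" for z
    by (rule pd_eqI(1)[OF *[OF that]])
qed

text \<open>Differentiation under the integral in Cauchy's formula for \<open>pd1 f\<close> shows that \<open>pd1 f\<close> is
holomorphic in the second variable; in the first variable it is so as a derivative.\<close>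

lemma hol2_pd1:
  assumes "open U" "hol2 U f"
  shows "hol2 U (pd1 f)"
proof -
  have "\<exists>V. open V \<and> z \<in> V \<and> hol2 V (pd1 f)" if "z \<in> U" for z
  proof -
    obtain x y where z: "z = (x, y)" by (cases z)
    obtain A B where AB: "open A" "open B" "z \<in> A \<times> B" "A \<times> B \<subseteq> U"
      using open_prod_elim[OF assms(1) \<open>z \<in> U\<close>] by metis
    obtain r where r: "0 < r" "cball x r \<subseteq> A" using AB z open_contains_cball[of A] by auto
    obtain s where s: "0 < s" "ball y s \<subseteq> B" using AB z open_contains_ball[of B] by auto
    have mem: "(t, u) \<in> U" if "t \<in> cball x r" "u \<in> ball y s" for t u
      using that r s AB by blast
    have hx: "(\<lambda>t. f (t, u)) holomorphic_on ball x r"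
      and hxc: "continuous_on (cball x r) (\<lambda>t. f (t, u))" if "u \<in> ball y s" for u
    proof -
      have d: "(\<lambda>t. f (t, u)) field_differentiable at t" if "t \<in> cball x r" for t
        using hol2_pd_fields(1)[OF assms(2) mem[OF that \<open>u \<in> ball y s\<close>]]
        by (auto simp: field_differentiable_def)
      show "(\<lambda>t. f (t, u)) holomorphic_on ball x r"
        unfolding holomorphic_on_def by (simp add: field_differentiable_at_within[OF d])
      show "continuous_on (cball x r) (\<lambda>t. f (t, u))"
        using d by (meson continuous_at_imp_continuous_on field_differentiable_imp_continuous_at)
    qed
    have hy: "(\<lambda>u. f (t, u)) holomorphic_on ball y s" if "t \<in> cball x r" for t
      unfolding holomorphic_on_def
    proof
      fix u assume "u \<in> ball y s"
      from hol2_pd_fields(2)[OF assms(2) mem[OF that this]]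
      show "(\<lambda>u. f (t, u)) field_differentiable at u within ball y s"
        by (meson field_differentiable_def field_differentiable_at_within)
    qed
    have contf: "continuous_on U f" by (rule hol2_continuous_on[OF assms(2)])
    have "continuous_on (ball x r \<times> ball y s) (\<lambda>(t, u). deriv (\<lambda>t. f (t, u)) t)"
    proof (rule deriv_continuous_on_param[OF open_ball _ hx])
      show "continuous_on (ball x r \<times> ball y s) (\<lambda>(t, u). f (t, u))"
        using continuous_on_subset[OF contf] mem by (simp add: subset_iff)
    qed
    then have c: "continuous_on (ball x r \<times> ball y s) (pd1 f)"
      by (simp add: pd1_def[abs_def] case_prod_beta)
    have "hol2 (ball x r \<times> ball y s) (pd1 f)"
    proof (rule hol2I_holomorphic[OF _ c])
      fix t u assume tu: "(t, u) \<in> ball x r \<times> ball y s"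
      have "(\<lambda>t. pd1 f (t, u)) holomorphic_on ball x r"
        using holomorphic_deriv[OF hx] tu by (simp add: pd1_def)
      then show "\<exists>S. open S \<and> t \<in> S \<and> (\<lambda>t. pd1 f (t, u)) holomorphic_on S" using tu by blast
      have "(\<lambda>u. contour_integral (circlepath x r) (\<lambda>w. f (w, u) / (w - t)^2)) holomorphic_on ball y s"
      proof (rule holomorphic_circle_integral)
        have "continuous_on (ball y s \<times> sphere x r) (\<lambda>q. f (snd q, fst q))"
          by (rule continuous_on_compose2[OF contf])
            (use mem in \<open>auto intro!: continuous_intros\<close>)
        moreover have "snd q - t \<noteq> 0" if "q \<in> ball y s \<times> sphere x r" for q
          using that tu by auto
        ultimately show "continuous_on (ball y s \<times> sphere x r) (\<lambda>(u, w). f (w, u) / (w - t)^2)"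
          unfolding case_prod_beta by (intro continuous_intros) auto
        show "(\<lambda>u. f (w, u) / (w - t)^2) holomorphic_on ball y s" if "w \<in> sphere x r" for w
          by (intro holomorphic_intros hy) (use that tu in auto)
      qed (use r in auto)
      then have "(\<lambda>u. 1 / (2 * of_real pi * \<i>) * contour_integral (circlepath x r) (\<lambda>w. f (w, u) / (w - t)^2))
          holomorphic_on ball y s"
        by (intro holomorphic_intros)
      moreover have "1 / (2 * of_real pi * \<i>) * contour_integral (circlepath x r) (\<lambda>w. f (w, u) / (w - t)^2)
          = pd1 f (t, u)" if "u \<in> ball y s" for u
        using Cauchy_derivative_integral_circlepath(2)[OF hxc[OF that] hx[OF that], of t] tu
        by (auto simp: pd1_def intro!: DERIV_imp_deriv[symmetric])
      ultimately have "(\<lambda>u. pd1 f (t, u)) holomorphic_on ball y s"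
        by (rule holomorphic_transform)
      then show "\<exists>S. open S \<and> u \<in> S \<and> (\<lambda>u. pd1 f (t, u)) holomorphic_on S" using tu by blast
    qed (auto intro: open_Times)
    then show ?thesis using z r s
      by (intro exI[of _ "ball x r \<times> ball y s"]) (auto intro: open_Times)
  qed
  then show ?thesis by (rule hol2_local)
qed

lemma hol2_pd2:
  assumes "open U" "hol2 U f"
  shows "hol2 U (pd2 f)"
proof -
  have "open (prod.swap -` U)"
    by (intro open_vimage assms(1) continuous_on_swap)
  moreover have "prod.swap ` U = prod.swap -` U" by force
  ultimately have o: "open (prod.swap ` U)" by simp
  have "hol2 (prod.swap ` prod.swap ` U) (\<lambda>z. pd1 (\<lambda>z. f (prod.swap z)) (prod.swap z))"
    by (rule hol2_swap(1)[OF hol2_pd1[OF o hol2_swap(1)[OF assms(2)]]])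
  then have "hol2 U (\<lambda>z. pd1 (\<lambda>z. f (prod.swap z)) (prod.swap z))"
    by (simp add: image_image)
  then show ?thesis
    by (rule hol2_cong[OF assms(1)]) (rule hol2_swap(2)[OF assms(2)])
qed

text \<open>The total derivative in coordinates. Products, powers and compositions have explicit partial
derivatives in this form, while \<open>pd1\<close> and \<open>pd2\<close> alone do not record that the function is
differentiable.\<close>

definition has_pds :: "(complex \<times> complex \<Rightarrow> complex) \<Rightarrow> complex \<times> complex \<Rightarrow> complex \<Rightarrow> complex \<Rightarrow> bool" where
  "has_pds f z a b \<longleftrightarrow> (f has_derivative (\<lambda>v. a * fst v + b * snd v)) (at z)"

lemma hol2_iff: "hol2 U f \<longleftrightarrow> (\<forall>z\<in>U. \<exists>a b. has_pds f z a b)"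
  unfolding hol2_def has_pds_def ..

lemma has_pds_pd: "hol2 U f \<Longrightarrow> z \<in> U \<Longrightarrow> has_pds f z (pd1 f z) (pd2 f z)"
  unfolding has_pds_def by (rule hol2_has_derivative)

lemma has_pds_eq:
  assumes "has_pds f z a b"
  shows "pd1 f z = a" "pd2 f z = b"
  using assms unfolding has_pds_def by (rule pd_eqI)+

lemma has_pds_const: "has_pds (\<lambda>_. c) z 0 0"
  and has_pds_fst: "has_pds fst z 1 0"
  and has_pds_snd: "has_pds snd z 0 1"
  unfolding has_pds_def by (auto intro!: derivative_eq_intros)

lemma has_pds_add:
  assumes "has_pds f z a b" "has_pds g z c d"
  shows "has_pds (\<lambda>z. f z + g z) z (a + c) (b + d)"
  using has_derivative_add[OF assms[unfolded has_pds_def]]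
  unfolding has_pds_def by (simp add: algebra_simps)

lemma has_pds_diff:
  assumes "has_pds f z a b" "has_pds g z c d"
  shows "has_pds (\<lambda>z. f z - g z) z (a - c) (b - d)"
  using has_derivative_diff[OF assms[unfolded has_pds_def]]
  unfolding has_pds_def by (simp add: algebra_simps)

lemma has_pds_mult:
  assumes "has_pds f z a b" "has_pds g z c d"
  shows "has_pds (\<lambda>z. f z * g z) z (a * g z + f z * c) (b * g z + f z * d)"
  using has_derivative_mult[OF assms[unfolded has_pds_def]]
  unfolding has_pds_def by (simp add: algebra_simps)

lemma has_pds_compose:
  assumes "(h has_field_derivative h') (at (f z))" "has_pds f z a b"
  shows "has_pds (\<lambda>z. h (f z)) z (h' * a) (h' * b)"
  using has_derivative_compose[OF assms(2)[unfolded has_pds_def] assms(1)[unfolded has_field_derivative_def]]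
  unfolding has_pds_def by (simp add: algebra_simps)

lemma has_pds_sum:
  assumes "\<And>i. i \<in> I \<Longrightarrow> has_pds (f i) z (a i) (b i)"
  shows "has_pds (\<lambda>z. \<Sum>i\<in>I. f i z) z (\<Sum>i\<in>I. a i) (\<Sum>i\<in>I. b i)"
  using has_derivative_sum[of I f "\<lambda>i v. a i * fst v + b i * snd v"] assms
  unfolding has_pds_def by (simp add: sum.distrib sum_distrib_right)

lemma hol2_const: "hol2 U (\<lambda>_. c)"
  and hol2_fst: "hol2 U fst"
  and hol2_snd: "hol2 U snd"
  unfolding hol2_iff using has_pds_const has_pds_fst has_pds_snd by blast+

lemma hol2_add: "hol2 U f \<Longrightarrow> hol2 U g \<Longrightarrow> hol2 U (\<lambda>z. f z + g z)"
  and hol2_diff: "hol2 U f \<Longrightarrow> hol2 U g \<Longrightarrow> hol2 U (\<lambda>z. f z - g z)"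
  and hol2_mult: "hol2 U f \<Longrightarrow> hol2 U g \<Longrightarrow> hol2 U (\<lambda>z. f z * g z)"
  unfolding hol2_iff by (blast intro: has_pds_add has_pds_diff has_pds_mult)+

lemma hol2_sum: "(\<And>i. i \<in> I \<Longrightarrow> hol2 U (f i)) \<Longrightarrow> hol2 U (\<lambda>z. \<Sum>i\<in>I. f i z)"
  by (induction I rule: infinite_finite_induct) (auto intro: hol2_const hol2_add)

lemma hol2_power: "hol2 U f \<Longrightarrow> hol2 U (\<lambda>z. f z ^ n)"
  by (induction n) (auto intro: hol2_const hol2_mult)

lemma hol2_compose:
  assumes "h holomorphic_on S" "open S" "hol2 U f" "f ` U \<subseteq> S"
  shows "hol2 U (\<lambda>z. h (f z))"
  unfolding hol2_iff
proof
  fix z assume z: "z \<in> U"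
  then have "(h has_field_derivative deriv h (f z)) (at (f z))"
    using assms holomorphic_derivI by blast
  from has_pds_compose[where h=h and f=f, OF this has_pds_pd[OF assms(3) z]]
  show "\<exists>a b. has_pds (\<lambda>z. h (f z)) z a b" by blast
qed

lemmas hol2_intros = hol2_const hol2_fst hol2_snd hol2_add hol2_diff hol2_mult hol2_sum hol2_power

lemma hol2_inverse:
  assumes "hol2 U f" "\<And>z. z \<in> U \<Longrightarrow> f z \<noteq> 0"
  shows "hol2 U (\<lambda>z. inverse (f z))"
  by (rule hol2_compose[of inverse "- {0}"])
    (use assms in \<open>auto intro!: holomorphic_intros\<close>)

lemma hol2_divide:
  assumes "hol2 U f" "hol2 U g" "\<And>z. z \<in> U \<Longrightarrow> g z \<noteq> 0"
  shows "hol2 U (\<lambda>z. f z / g z)"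
  unfolding divide_inverse by (intro hol2_mult hol2_inverse assms)

lemma has_pds_divide:
  assumes "has_pds f z a b" "has_pds g z c d" "g z \<noteq> 0"
  shows "has_pds (\<lambda>z. f z / g z) z ((a * g z - f z * c) / (g z)^2) ((b * g z - f z * d) / (g z)^2)"
proof -
  have "(inverse has_field_derivative - ((inverse (g z))^2)) (at (g z))"
    using assms(3) by (auto intro!: derivative_eq_intros simp: power2_eq_square)
  note d = has_pds_mult[OF assms(1) has_pds_compose[where h=inverse, OF this assms(2)]]
  have e: "(x * g z - f z * y) / (g z)^2 = x * inverse (g z) + f z * (- ((inverse (g z))^2) * y)" for x y
    using assms(3) by (simp add: field_simps power2_eq_square)
  have fg: "(\<lambda>z. f z / g z) = (\<lambda>z. f z * inverse (g z))" by (simp add: divide_inverse)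
  show ?thesis unfolding e fg by (rule d)
qed

section \<open>Linear frames and the tangent cone\<close>

lemma holomorphic_factor_out_zero:
  assumes "g holomorphic_on ball 0 R" "g 0 = 0"
  obtains g' where "g' holomorphic_on ball 0 R" "\<And>x. x \<in> ball 0 R \<Longrightarrow> g x = x * g' x"
proof
  show "(\<lambda>z. if z = 0 then deriv g 0 else (g z - g 0) / (z - 0)) holomorphic_on ball 0 R"
    by (rule pole_lemma_open) (use assms in auto)
qed (use assms in auto)

lemma holomorphic_isCont_centre:
  "g holomorphic_on ball z R \<Longrightarrow> 0 < R \<Longrightarrow> isCont g z"
  using continuous_on_eq_continuous_at[OF open_ball, of z R g] holomorphic_on_imp_continuous_on[of g "ball z R"]
  by simp

text \<open>A nonzero holomorphic function has a finite order at the centre, so divisibility by all powers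
forces it to vanish.\<close>

lemma holomorphic_flat_zero:
  assumes flat: "\<And>n. \<exists>g. g holomorphic_on ball 0 R \<and> (\<forall>x\<in>ball 0 R. h x = x ^ n * g x)"
    and "x \<in> ball 0 R"
  shows "h x = 0"
proof (rule ccontr)
  assume nz: "h x \<noteq> 0"
  have R: "0 < R" using assms(2) le_less_trans[OF norm_ge_zero, of x R] by simp
  have hol: "h holomorphic_on ball 0 R" 
  proof -
    obtain g where "g holomorphic_on ball 0 R" "\<forall>x\<in>ball 0 R. h x = x ^ 0 * g x"
      using flat[of 0] by blast
    then show ?thesis using holomorphic_transform[of g "ball 0 R" h] by simp
  qed
  have h0: "h 0 = 0" using flat[of 1] R by auto
  have nc: "\<not> h constant_on ball 0 R" 
  proof
    assume "h constant_on ball 0 R"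
    then obtain c where "\<And>x. x \<in> ball 0 R \<Longrightarrow> h x = c" unfolding constant_on_def by blast
    from this[of x] this[of 0] show False using nz h0 assms(2) R by simp
  qed
  obtain g r n where g: "0 < n" "0 < r" "ball (0 :: complex) r \<subseteq> ball 0 R" "g holomorphic_on ball 0 r"
    "\<And>w. w \<in> ball 0 r \<Longrightarrow> h w = (w - 0) ^ n * g w" "\<And>w. w \<in> ball 0 r \<Longrightarrow> g w \<noteq> 0"
  proof (rule holomorphic_factor_zero_nonconstant[OF hol open_ball connected_ball _ h0 nc])
    show "0 \<in> ball 0 R" using R by simp
  qed (rule that)
  obtain k where k: "k holomorphic_on ball 0 R" "\<And>x. x \<in> ball 0 R \<Longrightarrow> h x = x ^ Suc n * k x"
    using flat[of "Suc n"] by blast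
  have eq: "g w = w * k w" if "w \<in> ball 0 r - {0}" for w
    using subsetD[OF g(3), of w] g(5)[of w] k(2)[of w] that by auto
  have "g 0 = 0 * k 0"
  proof (rule tendsto_unique[OF trivial_limit_at])
    have "isCont g 0"
      using g(2,4) holomorphic_isCont_centre by blast
    then show "(g \<longlongrightarrow> g 0) (at 0)" by (simp add: isCont_def)
    have "isCont k 0"
      using R k(1) holomorphic_isCont_centre by blast
    then have "((\<lambda>w. w * k w) \<longlongrightarrow> 0 * k 0) (at 0)" by (intro tendsto_intros) (simp add: isCont_def)
    moreover have "eventually (\<lambda>w. w * k w = g w) (at 0)"
      unfolding eventually_at using g(2) eq by (intro exI[of _ r]) (auto simp: dist_commute)
    ultimately show "(g \<longlongrightarrow> 0 * k 0) (at 0)" by (rule Lim_transform_eventually)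
  qed
  then show False using g(6)[of 0] g(2) by simp
qed

text \<open>The point with coordinates \<open>z\<close> in the frame with origin \<open>p\<close> and basis vectors \<open>e\<close>, \<open>v\<close>. With
first coordinate \<open>0\<close> it runs through the complex line through \<open>p\<close> in direction \<open>v\<close>.\<close>

definition frame_pt :: "complex \<times> complex \<Rightarrow> complex \<times> complex \<Rightarrow> complex \<times> complex \<Rightarrow> complex \<times> complex \<Rightarrow> complex \<times> complex" where
  "frame_pt p e v z = (fst p + fst z * fst e + snd z * fst v, snd p + fst z * snd e + snd z * snd v)"

lemma dist_frame_pt:
  "dist p (frame_pt p e v z) \<le> cmod (fst z) * norm e + cmod (snd z) * norm v"
proof -
  have c: "norm (c * fst w, c * snd w) = cmod c * norm w" for c :: complex and w :: "complex \<times> complex"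
  proof -
    have "norm (c * fst w, c * snd w) = sqrt ((cmod c)\<^sup>2 * ((cmod (fst w))\<^sup>2 + (cmod (snd w))\<^sup>2))"
      by (simp add: norm_prod_def norm_mult power_mult_distrib distrib_left)
    then show ?thesis by (simp add: real_sqrt_mult norm_prod_def)
  qed
  have "dist p (frame_pt p e v z) = norm (frame_pt p e v z - p)" by (simp add: dist_norm norm_minus_commute)
  also have "frame_pt p e v z - p = (fst z * fst e, fst z * snd e) + (snd z * fst v, snd z * snd v)"
    by (simp add: frame_pt_def prod_eq_iff)
  also have "norm \<dots> \<le> norm (fst z * fst e, fst z * snd e) + norm (snd z * fst v, snd z * snd v)"
    by (rule norm_triangle_ineq)
  finally show ?thesis by (simp add: c)
qed

lemma frame_pt_has_derivative: "(frame_pt p e v has_derivative (\<lambda>h. frame_pt 0 e v h)) (at z)"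
  unfolding frame_pt_def by (auto intro!: derivative_eq_intros simp: algebra_simps)

lemma continuous_on_frame_pt: "continuous_on S (frame_pt p e v)"
  unfolding frame_pt_def by (intro continuous_intros)

lemma hol2_compose_frame_pt:
  assumes "hol2 U f" "frame_pt p e v ` V \<subseteq> U"
  shows "hol2 V (\<lambda>z. f (frame_pt p e v z))"
  unfolding hol2_def
proof
  fix z assume "z \<in> V"
  then have "frame_pt p e v z \<in> U" using assms(2) by blast
  from has_derivative_compose[OF frame_pt_has_derivative hol2_has_derivative[OF assms(1) this]]
  have "((\<lambda>z. f (frame_pt p e v z)) has_derivative
      (\<lambda>h. (pd1 f (frame_pt p e v z) * fst e + pd2 f (frame_pt p e v z) * snd e) * fst h +
           (pd1 f (frame_pt p e v z) * fst v + pd2 f (frame_pt p e v z) * snd v) * snd h)) (at z)"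
    by (simp add: frame_pt_def algebra_simps)
  then show "\<exists>a b. ((\<lambda>z. f (frame_pt p e v z)) has_derivative (\<lambda>h. a * fst h + b * snd h)) (at z)"
    by (intro exI)
qed

lemma holomorphic_on_line:
  assumes "hol2 (ball p R) f" "norm w < 1"
  shows "(\<lambda>t. f (frame_pt p e w (0, t))) holomorphic_on ball 0 R"
proof -
  have m: "frame_pt p e w (0, t) \<in> ball p R" if "t \<in> ball 0 R" for t
  proof -
    have "cmod t * norm w \<le> cmod t * 1" using assms(2) by (intro mult_left_mono) auto
    with dist_frame_pt[of p e w "(0, t)"] that show ?thesis by auto
  qed
  have h: "hol2 ((\<lambda>t. (0, t)) ` ball 0 R) (\<lambda>z. f (frame_pt p e w z))"
    by (rule hol2_compose_frame_pt[OF assms(1)]) (use m in auto)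
  show ?thesis
    unfolding holomorphic_on_def
  proof
    fix t :: complex assume "t \<in> ball 0 R"
    then have "(0, t) \<in> (\<lambda>t. (0::complex, t)) ` ball 0 R" by blast
    from has_field_derivative_at_within[OF hol2_pd_fields(2)[OF h this]]
    show "(\<lambda>t. f (frame_pt p e w (0, t))) field_differentiable at t within ball 0 R"
      unfolding field_differentiable_def by blast
  qed
qed

lemma ball_on_line:
  assumes "z \<in> ball p R"
  obtains w s where "norm w < 1" "s \<in> ball 0 R" "frame_pt p e w (0, s) = z"
proof -
  obtain s where s: "dist p z < s" "s < R" using assms dense by auto
  then have s0: "0 < s" using le_less_trans[OF zero_le_dist] by blast
  define w where "w = (inverse s) *\<^sub>R (z - p)"
  have "norm w < 1"
    using s s0 unfolding w_def norm_scaleR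
    by (simp add: dist_norm norm_minus_commute pos_divide_less_eq divide_inverse[symmetric] mult.commute[of "inverse s"])
  moreover have "frame_pt p e w (0, of_real s) = z"
    using s0 by (simp add: frame_pt_def w_def prod_eq_iff scaleR_conv_of_real flip: mult.assoc)
  ultimately show thesis using that[of w "of_real s"] s s0 by simp
qed

text \<open>The restrictions of \<open>f\<close> to the lines through \<open>p\<close> have a least order \<open>n\<close> at \<open>p\<close> (the multiplicity
of \<open>f\<close>), for if all orders were infinite then \<open>f\<close> would vanish on the whole ball.\<close>

lemma minimal_order_direction:
  assumes hol: "hol2 (ball p R) f" and nz: "z \<in> ball p R" "f z \<noteq> 0"
  obtains v n g where "norm v < 1" "g holomorphic_on ball 0 R" "g 0 \<noteq> 0"
    "\<And>t. t \<in> ball 0 R \<Longrightarrow> f (frame_pt p 0 v (0, t)) = t ^ n * g t"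
    "\<And>w. norm w < 1 \<Longrightarrow> \<exists>h. h holomorphic_on ball 0 R \<and>
        (\<forall>t\<in>ball 0 R. f (frame_pt p 0 w (0, t)) = t ^ n * h t)"
proof -
  have R: "0 < R" using nz(1) le_less_trans[OF zero_le_dist, of p z R] by simp
  define P where "P = (\<lambda>n. \<forall>w. norm w < 1 \<longrightarrow> (\<exists>h. h holomorphic_on ball 0 R \<and>
        (\<forall>t\<in>ball 0 R. f (frame_pt p 0 w (0, t)) = t ^ n * h t)))"
  have P0: "P 0"
    unfolding P_def
  proof (intro allI impI)
    fix w :: "complex \<times> complex" assume "norm w < 1"
    from holomorphic_on_line[OF hol this, of 0]
    show "\<exists>h. h holomorphic_on ball 0 R \<and> (\<forall>t\<in>ball 0 R. f (frame_pt p 0 w (0, t)) = t ^ 0 * h t)"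
      by (intro exI[of _ "\<lambda>t. f (frame_pt p 0 w (0, t))"]) simp
  qed
  have "\<exists>n. \<not> P n"
  proof (rule ccontr)
    assume "\<nexists>n. \<not> P n"
    then have P: "P n" for n by blast
    obtain w s where w: "norm w < 1" "s \<in> ball 0 R" "frame_pt p 0 w (0, s) = z"
      by (rule ball_on_line[OF nz(1)])
    have "f (frame_pt p 0 w (0, s)) = 0"
    proof (rule holomorphic_flat_zero[OF _ w(2), of "\<lambda>t. f (frame_pt p 0 w (0, t))"])
      show "\<exists>g. g holomorphic_on ball 0 R \<and> (\<forall>x\<in>ball 0 R. f (frame_pt p 0 w (0, x)) = x ^ n * g x)" for n
        using P[of n] w(1) unfolding P_def by blast
    qed
    then show False using nz(2) w(3) by simp
  qed
  then obtain n where n: "P n" "\<not> P (Suc n)" using P0 by (metis nat_induct)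
  then obtain v where v: "norm v < 1" and nv: "\<nexists>h. h holomorphic_on ball 0 R \<and>
        (\<forall>t\<in>ball 0 R. f (frame_pt p 0 v (0, t)) = t ^ Suc n * h t)"
    unfolding P_def by blast
  obtain g where g: "g holomorphic_on ball 0 R" "\<And>t. t \<in> ball 0 R \<Longrightarrow> f (frame_pt p 0 v (0, t)) = t ^ n * g t"
    using n(1) v unfolding P_def by blast
  have "g 0 \<noteq> 0"
  proof
    assume "g 0 = 0"
    then obtain g' where "g' holomorphic_on ball 0 R" "\<And>x. x \<in> ball 0 R \<Longrightarrow> g x = x * g' x"
      using holomorphic_factor_out_zero[OF g(1)] by blast
    with g(2) have "\<forall>t\<in>ball 0 R. f (frame_pt p 0 v (0, t)) = t ^ Suc n * g' t" by simp
    with nv \<open>g' holomorphic_on ball 0 R\<close> show False by blast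
  qed
  with that[OF v g(1)] g(2) n(1) show thesis unfolding P_def by blast
qed

text \<open>Take \<open>v\<close> as a direction of least order \<open>n\<close>. On the neighbouring lines \<open>f\<close> is still divisible by
\<open>t\<^sup>n\<close>, and by the maximum principle the quotient is close to the one on the line of \<open>v\<close>, thus
nonzero. So near \<open>p\<close> there is no other zero of \<open>f\<close> in a cone around the line of \<open>v\<close>: that line is not tangent to
the curve.\<close>

lemma tangent_cone_coordinates:
  assumes "open U" "p \<in> U" and hol: "hol2 U f" and "f p = 0"
    and nz: "\<And>N. open N \<Longrightarrow> p \<in> N \<Longrightarrow> \<exists>z\<in>N. f z \<noteq> 0"
  obtains e v r R K n g where
    "fst e * snd v - snd e * fst v \<noteq> 0" "0 < r" "0 < R" "0 < K" "K * r < R"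
    "frame_pt p e v ` (ball 0 r \<times> ball 0 R) \<subseteq> U"
    "\<And>x y. y \<in> ball 0 R \<Longrightarrow> f (frame_pt p e v (x, y)) = 0 \<Longrightarrow> cmod y \<le> K * cmod x"
    "g holomorphic_on ball 0 R" "\<And>y. y \<in> ball 0 R \<Longrightarrow> g y \<noteq> 0"
    "\<And>y. y \<in> ball 0 R \<Longrightarrow> f (frame_pt p e v (0, y)) = y ^ n * g y"
proof -
  obtain R0 where R0: "0 < R0" "ball p R0 \<subseteq> U" using assms(1,2) open_contains_ball by metis
  have hol0: "hol2 (ball p R0) f" by (rule hol2_subset[OF hol R0(2)])
  obtain z where z: "z \<in> ball p R0" "f z \<noteq> 0" using nz[OF open_ball, of p R0] R0(1) by (meson centre_in_ball)
  obtain v n g where v: "norm v < 1" and g: "g holomorphic_on ball 0 R0" "g 0 \<noteq> 0"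
    "\<And>t. t \<in> ball 0 R0 \<Longrightarrow> f (frame_pt p 0 v (0, t)) = t ^ n * g t"
    and w: "\<And>w. norm w < 1 \<Longrightarrow> \<exists>h. h holomorphic_on ball 0 R0 \<and>
        (\<forall>t\<in>ball 0 R0. f (frame_pt p 0 w (0, t)) = t ^ n * h t)"
    by (rule minimal_order_direction[OF hol0 z]) (rule that)
  have contg: "isCont g 0"
    using R0(1) g(1) holomorphic_isCont_centre by blast
  have v0: "v \<noteq> 0"
  proof
    assume "v = 0"
    then have "frame_pt p 0 v (0, t) = p" for t by (simp add: frame_pt_def)
    then have eq: "g t = 0" if "t \<in> ball 0 R0 - {0}" for t using g(3)[of t] that \<open>f p = 0\<close> by auto
    have "(g \<longlongrightarrow> 0) (at 0)"
    proof (rule Lim_transform_eventually[OF tendsto_const])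
      show "eventually (\<lambda>t. 0 = g t) (at 0)"
        unfolding eventually_at using R0(1) eq by (intro exI[of _ R0]) (auto simp: dist_commute)
    qed
    then show False using contg g(2) tendsto_unique[OF trivial_limit_at, of g 0 0 "g 0"]
      by (auto simp: isCont_def)
  qed
  \<comment> \<open>A vector orthogonal to \<open>v\<close>; together they are a basis because the determinant is \<open>\<parallel>v\<parallel>\<^sup>2\<close>.\<close>
  define e where "e = (cnj (snd v), - cnj (fst v))"
  have ne: "norm e = norm v" by (simp add: e_def norm_prod_def add.commute)
  have "fst e * snd v - snd e * fst v = of_real ((norm v)\<^sup>2)"
    by (simp add: e_def norm_prod_def complex_norm_square mult.commute del: of_real_power)
  with v0 have J: "fst e * snd v - snd e * fst v \<noteq> 0" by simp
  define d0 where "d0 = (1 - norm v) / 2"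
  have d0: "0 < d0" "norm v + d0 < 1" using v by (auto simp: d0_def field_simps)
  obtain q where q: "0 < q" "\<And>t. dist t 0 < q \<Longrightarrow> dist (g t) (g 0) < cmod (g 0) / 2"
    using contg g(2) unfolding continuous_at_eps_delta by (metis half_gt_zero zero_less_norm_iff)
  define R where "R = min (q / 2) (R0 / 2)"
  have R: "0 < R" "R < R0" "R \<le> R0 / 2" using q R0 by (auto simp: R_def)
  have gb: "cmod (g t) > cmod (g 0) / 2" if "t \<in> cball 0 R" for t
  proof -
    have "dist (g t) (g 0) < cmod (g 0) / 2" using q that by (auto simp: R_def)
    then show ?thesis using norm_triangle_ineq2[of "g 0" "g t"] by (simp add: dist_norm norm_minus_commute)
  qed
  let ?w = "\<lambda>\<xi>. (fst v + \<xi> * fst e, snd v + \<xi> * snd e)"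
  have weq: "?w \<xi> = frame_pt v e e (\<xi>, 0)" for \<xi> by (simp add: frame_pt_def)
  have nw: "norm (?w \<xi>) < 1" if "cmod \<xi> \<le> d0" for \<xi>
  proof -
    have "norm (?w \<xi>) \<le> norm v + dist v (?w \<xi>)"
      by (metis dist_norm norm_minus_commute norm_triangle_sub)
    also have "dist v (?w \<xi>) \<le> cmod \<xi> * norm e"
      using dist_frame_pt[of v e e "(\<xi>, 0)"] unfolding weq by simp
    also have "\<dots> \<le> d0 * 1" using that ne v d0 by (intro mult_mono) auto
    finally show ?thesis using d0 by simp
  qed
  have weq2: "frame_pt p 0 (?w \<xi>) (0, t) = frame_pt p e v (t * \<xi>, t)" for \<xi> t
    by (simp add: frame_pt_def algebra_simps)
  let ?H = "\<lambda>q. f (frame_pt p e v (snd q * fst q, snd q))"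
  let ?C = "cball (0 :: complex) d0 \<times> sphere (0 :: complex) R"
  have sub: "frame_pt p e v (t * \<xi>, t) \<in> ball p R0" if "cmod \<xi> \<le> d0" "cmod t < R0" for t \<xi>
  proof -
    have "dist p (frame_pt p 0 (?w \<xi>) (0, t)) \<le> cmod t * norm (?w \<xi>)"
      using dist_frame_pt[of p 0 "?w \<xi>" "(0, t)"] by simp
    also have "\<dots> \<le> cmod t * 1" using nw[OF that(1)] by (intro mult_left_mono) auto
    finally show ?thesis using that unfolding weq2 by simp
  qed
  have "continuous_on ?C ?H"
  proof (rule continuous_on_compose2[OF hol2_continuous_on[OF hol0]])
    show "continuous_on ?C (\<lambda>q. frame_pt p e v (snd q * fst q, snd q))"
      by (intro continuous_on_compose2[OF continuous_on_frame_pt[of UNIV]] continuous_intros) auto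
    show "(\<lambda>q. frame_pt p e v (snd q * fst q, snd q)) ` ?C \<subseteq> ball p R0"
      using sub R by (auto simp del: mem_ball)
  qed
  moreover have "compact ?C" by (intro compact_Times compact_cball compact_sphere)
  ultimately have "uniformly_continuous_on ?C ?H" by (rule compact_uniformly_continuous)
  moreover define \<kappa> where "\<kappa> = cmod (g 0) / 2 * R ^ n"
  have \<kappa>: "0 < \<kappa>" using g(2) R by (simp add: \<kappa>_def)
  ultimately obtain d1 where d1: "0 < d1"
    "\<And>a b. a \<in> ?C \<Longrightarrow> b \<in> ?C \<Longrightarrow> dist b a < d1 \<Longrightarrow> dist (?H b) (?H a) < \<kappa>"
    unfolding uniformly_continuous_on_def by metis
  define \<delta> where "\<delta> = min d0 d1"
  have \<delta>: "0 < \<delta>" using d0 d1 by (simp add: \<delta>_def)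
  have key: "f (frame_pt p e v (t * \<xi>, t)) \<noteq> 0" if \<xi>: "cmod \<xi> < \<delta>" and t: "t \<noteq> 0" "cmod t \<le> R" for \<xi> t
  proof -
    obtain h where h: "h holomorphic_on ball 0 R0"
      "\<And>t. t \<in> ball 0 R0 \<Longrightarrow> f (frame_pt p e v (t * \<xi>, t)) = t ^ n * h t"
      using w[OF nw[of \<xi>]] \<xi> unfolding weq2 by (auto simp: \<delta>_def)
    have g3: "f (frame_pt p e v (0, t)) = t ^ n * g t" if "t \<in> ball 0 R0" for t
      using g(3)[OF that] by (simp add: frame_pt_def)
    have "cmod (h t - g t) \<le> cmod (g 0) / 2"
    proof (rule maximum_modulus_frontier[of "\<lambda>t. h t - g t" "cball 0 R"])
      have s: "cball 0 R \<subseteq> ball 0 R0" using R by auto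
      have hg: "(\<lambda>t. h t - g t) holomorphic_on ball 0 R0" by (intro holomorphic_intros h g)
      show "(\<lambda>t. h t - g t) holomorphic_on interior (cball 0 R)"
        by (rule holomorphic_on_subset[OF hg]) (use s interior_subset in blast)
      show "continuous_on (closure (cball 0 R)) (\<lambda>t. h t - g t)"
        using holomorphic_on_imp_continuous_on[OF hg] s by (auto intro: continuous_on_subset)
      fix u :: complex assume "u \<in> frontier (cball 0 R)"
      then have u: "cmod u = R" by (simp add: frontier_cball)
      have "dist (?H (\<xi>, u)) (?H (0, u)) < \<kappa>"
        using d1(2)[of "(0, u)" "(\<xi>, u)"] u \<xi> d0 by (simp add: \<delta>_def dist_Pair_Pair)
      moreover have "?H (\<xi>, u) - ?H (0, u) = u ^ n * (h u - g u)"
        using h(2)[of u] g3[of u] u R by (simp add: algebra_simps)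
      ultimately have "R ^ n * cmod (h u - g u) < \<kappa>"
        by (simp add: dist_norm norm_mult norm_power u)
      then show "cmod (h u - g u) \<le> cmod (g 0) / 2"
        using R by (simp add: \<kappa>_def mult.commute)
    qed (use t in auto)
    with gb[of t] t have "h t \<noteq> 0" by auto
    then show ?thesis using h(2)[of t] t R by auto
  qed
  define r where "r = min (R0 / 2) (R * \<delta> / 2)"
  show thesis
  proof (rule that[OF J])
    show "0 < r" "0 < R" "0 < 1 / \<delta>" using R R0 \<delta> by (auto simp: r_def)
    have "r \<le> R * \<delta> / 2" by (simp add: r_def)
    then show "1 / \<delta> * r < R"
      using \<delta> R by (simp add: field_simps) (smt (verit) mult_pos_pos)
    show "frame_pt p e v ` (ball 0 r \<times> ball 0 R) \<subseteq> U"
    proof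
      fix z assume "z \<in> frame_pt p e v ` (ball 0 r \<times> ball 0 R)"
      then obtain x y where xy: "z = frame_pt p e v (x, y)" "cmod x < r" "cmod y < R" by auto
      have "dist p z \<le> cmod x * norm e + cmod y * norm v" using dist_frame_pt[of p e v "(x, y)"] xy by simp
      also have "\<dots> \<le> cmod x * 1 + cmod y * 1"
        using ne v by (intro add_mono mult_left_mono) auto
      also have "\<dots> < R0" using xy R by (auto simp: r_def)
      finally show "z \<in> U" using R0(2) by auto
    qed
    show "cmod y \<le> 1 / \<delta> * cmod x" if "y \<in> ball 0 R" "f (frame_pt p e v (x, y)) = 0" for x y
    proof (rule ccontr)
      assume "\<not> cmod y \<le> 1 / \<delta> * cmod x"
      then have "cmod x < \<delta> * cmod y" using \<delta> by (simp add: field_simps)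
      moreover from this have "y \<noteq> 0" by auto
      ultimately have "cmod (x / y) < \<delta>" by (simp add: norm_divide field_simps)
      from key[OF this \<open>y \<noteq> 0\<close>] that \<open>y \<noteq> 0\<close> show False by simp
    qed
    show "g holomorphic_on ball 0 R" using g(1) R by (auto intro: holomorphic_on_subset)
    show "g y \<noteq> 0" if "y \<in> ball 0 R" for y using gb[of y] that by auto
    show "f (frame_pt p e v (0, y)) = y ^ n * g y" if "y \<in> ball 0 R" for y
      using g(3)[of y] that R by (simp add: frame_pt_def)
  qed
qed

section \<open>Weierstrass polynomials\<close>

text \<open>The product of the factors \<open>y - a\<close> with its coefficients in reverse order: the coefficient of
\<open>X\<^sup>k\<close> is, up to sign, the \<open>k\<close>-th elementary symmetric function of \<open>A\<close>. In this order the
place of a coefficient does not depend on the size of \<open>A\<close>.\<close>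

definition rev_poly :: "complex multiset \<Rightarrow> complex fps" where
  "rev_poly A = (\<Prod>a\<in>#A. 1 - fps_const a * fps_X)"

lemma rev_poly_empty [simp]: "rev_poly {#} = 1"
  by (simp add: rev_poly_def)

lemma rev_poly_add: "rev_poly (add_mset a A) = (1 - fps_const a * fps_X) * rev_poly A"
  by (simp add: rev_poly_def)

lemma rev_poly_add_nth:
  "fps_nth (rev_poly (add_mset a A)) 0 = fps_nth (rev_poly A) 0"
  "fps_nth (rev_poly (add_mset a A)) (Suc k) = fps_nth (rev_poly A) (Suc k) - a * fps_nth (rev_poly A) k"
  by (simp_all add: rev_poly_add left_diff_distrib mult.assoc)

lemma rev_poly_nth_0 [simp]: "fps_nth (rev_poly A) 0 = 1"
  by (induction A) (simp_all add: rev_poly_add_nth)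

lemma rev_poly_nth_eq_0: "size A < k \<Longrightarrow> fps_nth (rev_poly A) k = 0"
proof (induction A arbitrary: k)
  case empty then show ?case by (simp add: fps_one_nth)
next
  case (add a A)
  then show ?case by (cases k) (simp_all add: rev_poly_add_nth)
qed

lemma prod_mset_eq_rev_poly:
  "(\<Prod>a\<in>#A. y - a) = (\<Sum>k\<le>size A. fps_nth (rev_poly A) k * y ^ (size A - k))"
proof (induction A)
  case (add a A)
  let ?n = "size A" and ?G = "fps_nth (rev_poly A)"
  have "(\<Sum>k\<le>Suc ?n. fps_nth (rev_poly (add_mset a A)) k * y ^ (Suc ?n - k))
      = y ^ Suc ?n + (\<Sum>k\<le>?n. (?G (Suc k) - a * ?G k) * y ^ (?n - k))"
    by (simp add: sum.atMost_Suc_shift rev_poly_add_nth del: sum.atMost_Suc)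
  also have "\<dots> = (y ^ Suc ?n + (\<Sum>k\<le>?n. ?G (Suc k) * y ^ (?n - k))) - a * (\<Sum>k\<le>?n. ?G k * y ^ (?n - k))"
    by (simp add: algebra_simps sum_subtractf sum_distrib_left)
  also have "y ^ Suc ?n + (\<Sum>k\<le>?n. ?G (Suc k) * y ^ (?n - k)) = (\<Sum>k\<le>Suc ?n. ?G k * y ^ (Suc ?n - k))"
    by (simp add: sum.atMost_Suc_shift del: sum.atMost_Suc)
  also have "\<dots> = y * (\<Sum>k\<le>?n. ?G k * y ^ (?n - k))"
    by (simp add: rev_poly_nth_eq_0 sum_distrib_left Suc_diff_le mult.left_commute)
  also have "\<dots> - a * (\<Sum>k\<le>?n. ?G k * y ^ (?n - k)) = (\<Prod>a\<in>#add_mset a A. y - a)"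
    by (simp add: add left_diff_distrib)
  finally show ?case by simp
qed simp

lemma norm_rev_poly_nth_le:
  assumes "\<And>a. a \<in># A \<Longrightarrow> cmod a \<le> \<rho>" "0 \<le> \<rho>"
  shows "cmod (fps_nth (rev_poly A) k) \<le> 2 ^ size A * \<rho> ^ k"
  using assms(1)
proof (induction A arbitrary: k)
  case empty
  then show ?case using assms(2) by (simp add: fps_one_nth)
next
  case (add a A)
  show ?case
  proof (cases k)
    case (Suc j)
    have "cmod (fps_nth (rev_poly (add_mset a A)) k)
        \<le> cmod (fps_nth (rev_poly A) k) + cmod a * cmod (fps_nth (rev_poly A) j)"
      unfolding Suc rev_poly_add_nth by (metis norm_mult norm_triangle_ineq4)
    also have "\<dots> \<le> 2 ^ size A * \<rho> ^ k + \<rho> * (2 ^ size A * \<rho> ^ j)"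
      using add assms(2) by (intro add_mono mult_mono) auto
    finally show ?thesis by (simp add: Suc algebra_simps)
  qed (use one_le_power[of "2::real" "Suc (size A)"] in simp)
qed

text \<open>The logarithmic derivative of \<open>1 - a X\<close> is \<open>- a / (1 - a X)\<close>, a geometric series; summed over \<open>A\<close>
this gives the generating function of the power sums.\<close>

lemma rev_poly_deriv:
  "fps_deriv (rev_poly A) = - (Abs_fps (\<lambda>j. \<Sum>a\<in>#A. a ^ Suc j) * rev_poly A)"
proof (induction A)
  case empty
  have "Abs_fps (\<lambda>j. \<Sum>a\<in>#{#}. a ^ Suc j :: complex) = 0" by (rule fps_ext) simp
  then show ?case by simp
next
  case (add a A)
  let ?L = "1 - fps_const a * fps_X" and ?E = "Abs_fps (\<lambda>j. a ^ Suc j)"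
    and ?S = "Abs_fps (\<lambda>j. \<Sum>a\<in>#A. a ^ Suc j)"
  have "?E * ?L = ?E - fps_const a * (?E * fps_X)"
    by (simp only: right_diff_distrib mult_1_right mult.left_commute[of ?E "fps_const a"])
  also have "\<dots> = fps_const a"
  proof (rule fps_ext)
    fix j show "fps_nth (?E - fps_const a * (?E * fps_X)) j = fps_nth (fps_const a) j"
      by (cases j) simp_all
  qed
  finally have geo: "?E * ?L = fps_const a" .
  have S: "Abs_fps (\<lambda>j. \<Sum>a\<in>#add_mset a A. a ^ Suc j) = ?E + ?S"
    by (rule fps_ext) simp
  have dL: "fps_deriv ?L = - (?E * ?L)" unfolding geo by simp
  have ring: "L * - (T * G) + - (E * L) * G = - ((E + T) * (L * G))" for L T G E :: "complex fps"
    by (simp add: algebra_simps)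
  show ?case
    unfolding rev_poly_add fps_deriv_mult S add dL by (rule ring)
qed

lemma newton_identity:
  "of_nat (Suc k) * fps_nth (rev_poly A) (Suc k)
    = - (\<Sum>j\<le>k. (\<Sum>a\<in>#A. a ^ Suc j) * fps_nth (rev_poly A) (k - j))"
  using arg_cong[OF rev_poly_deriv[of A], of "\<lambda>f. fps_nth f k"]
  by (simp add: fps_mult_nth atLeast0AtMost)

text \<open>Newton's identities express the elementary symmetric functions as polynomials in the power
sums.\<close>

lemma holomorphic_rev_poly_nth:
  assumes "\<And>j. (\<lambda>x. \<Sum>a\<in>#B x. a ^ Suc j) holomorphic_on S"
  shows "(\<lambda>x. fps_nth (rev_poly (B x)) k) holomorphic_on S"
proof (induction k rule: less_induct)
  case (less k)
  show ?case
  proof (cases k)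
    case (Suc i)
    have "(\<lambda>x. - (\<Sum>j\<le>i. (\<Sum>a\<in>#B x. a ^ Suc j) * fps_nth (rev_poly (B x)) (i - j)) / of_nat (Suc i)) holomorphic_on S"
      by (intro holomorphic_intros assms less) (auto simp: Suc simp del: of_nat_Suc)
    moreover have "fps_nth (rev_poly (B x)) k
        = - (\<Sum>j\<le>i. (\<Sum>a\<in>#B x. a ^ Suc j) * fps_nth (rev_poly (B x)) (i - j)) / of_nat (Suc i)" for x
      unfolding newton_identity[symmetric] Suc by (simp del: of_nat_Suc)
    ultimately show ?thesis by presburger
  qed simp
qed

lemma sum_mset_replicate_sum:
  assumes "finite Z"
  shows "(\<Sum>a\<in>#(\<Sum>y\<in>Z. replicate_mset (m y) y). h a) = (\<Sum>y\<in>Z. of_nat (m y) * h y :: complex)"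
  using assms by induction auto

text \<open>The roots of \<open>F (x, _)\<close>, counted with multiplicity. By the argument principle a sum of a
holomorphic function over the roots is an integral over a fixed circle, and it depends
holomorphically on \<open>x\<close>. The number of roots is such a sum; it is an integer and hence constant.\<close>

lemma roots_multiset:
  assumes hol: "hol2 (ball 0 r \<times> ball 0 R) F" and "0 < r" "0 < R" "0 < K" "K * r < R"
    and zeros: "\<And>x y. x \<in> ball 0 r \<Longrightarrow> y \<in> ball 0 R \<Longrightarrow> F (x, y) = 0 \<Longrightarrow> cmod y \<le> K * cmod x"
    and g: "g holomorphic_on ball 0 R" "\<And>y. y \<in> ball 0 R \<Longrightarrow> g y \<noteq> 0"
      "\<And>y. y \<in> ball 0 R \<Longrightarrow> F (0, y) = y ^ n * g y"
  obtains A where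
    "\<And>x. x \<in> ball 0 r \<Longrightarrow> size (A x) = n"
    "\<And>x. x \<in> ball 0 r \<Longrightarrow> set_mset (A x) = {y \<in> ball 0 R. F (x, y) = 0}"
    "\<And>h. hol2 (ball 0 r \<times> ball 0 R) h \<Longrightarrow> (\<lambda>x. \<Sum>a\<in>#A x. h (x, a)) holomorphic_on ball 0 r"
proof -
  let ?D = "ball (0::complex) r \<times> ball (0::complex) R"
  have oD: "open ?D" by (intro open_Times open_ball)
  define Z where "Z = (\<lambda>x. {y \<in> ball 0 R. F (x, y) = 0})"
  define A where "A = (\<lambda>x. \<Sum>y\<in>Z x. replicate_mset (nat (zorder (\<lambda>t. F (x, t)) y)) y)"
  \<comment> \<open>Any radius between \<open>K * r\<close> and \<open>R\<close>: the circle then encloses all roots, for every \<open>x\<close>.\<close>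
  define s where "s = (K * r + R) / 2"
  have s: "K * r < s" "s < R" "0 < s" using assms by (auto simp: s_def intro: add_pos_pos)
  have slice: "(\<lambda>t. h (x, t)) holomorphic_on ball 0 R" "(\<lambda>x. h (x, y)) holomorphic_on ball 0 r"
    if h: "hol2 ?D h" and xy: "x \<in> ball 0 r" "y \<in> ball 0 R" for h x y
  proof -
    show "(\<lambda>t. h (x, t)) holomorphic_on ball 0 R"
      unfolding holomorphic_on_open[OF open_ball] using hol2_pd_fields(2)[OF h] xy by blast
    show "(\<lambda>x. h (x, y)) holomorphic_on ball 0 r"
      unfolding holomorphic_on_open[OF open_ball] using hol2_pd_fields(1)[OF h] xy by blast
  qed
  have Fx: "(\<lambda>t. F (x, t)) holomorphic_on ball 0 R" if "x \<in> ball 0 r" for x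
    using slice(1)[OF hol that, of 0] \<open>0 < R\<close> by simp
  have small: "cmod y < s" if "x \<in> ball 0 r" "y \<in> Z x" for x y
  proof -
    have "cmod y \<le> K * cmod x" using zeros that by (auto simp: Z_def)
    also have "\<dots> < K * r" using that \<open>0 < K\<close> by auto
    finally show ?thesis using s by simp
  qed
  have nz: "F (x, of_real s) \<noteq> 0" if "x \<in> ball 0 r" for x
    using small[OF that, of "of_real s"] s by (auto simp: Z_def)
  have finZ: "finite (Z x)" if x: "x \<in> ball 0 r" for x
  proof (cases "Z x = {}")
    case False
    have nc: "\<not> (\<lambda>t. F (x, t)) constant_on ball 0 R"
    proof
      assume "(\<lambda>t. F (x, t)) constant_on ball 0 R"
      then obtain c where c: "\<And>t. t \<in> ball 0 R \<Longrightarrow> F (x, t) = c" unfolding constant_on_def by blast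
      from False c have "c = 0" by (auto simp: Z_def)
      with c[of "of_real s"] nz[OF x] s show False by simp
    qed
    have "finite {y \<in> cball 0 s. F (x, y) = 0}"
      by (rule holomorphic_compact_finite_zeros[OF Fx[OF x] open_ball connected_ball compact_cball _ nc])
        (use s in auto)
    then show ?thesis
      by (rule finite_subset[rotated]) (use small[OF x] in \<open>auto simp: Z_def less_imp_le\<close>)
  qed simp
  have zpos: "0 < zorder (\<lambda>t. F (x, t)) y" if x: "x \<in> ball 0 r" and y: "y \<in> Z x" for x y
  proof -
    have "\<exists>w\<in>ball 0 R. F (x, w) \<noteq> 0"
      using nz[OF x] s by (intro bexI[of _ "of_real s"]) auto
    from zorder_exist_zero[OF Fx[OF x] open_ball connected_ball _ this, of y] y
    show ?thesis by (auto simp: Z_def)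
  qed
  have sumA: "(\<Sum>a\<in>#A x. h a) = (\<Sum>y\<in>Z x. of_nat (nat (zorder (\<lambda>t. F (x, t)) y)) * h y)"
    if "x \<in> ball 0 r" for x and h :: "complex \<Rightarrow> complex"
    unfolding A_def by (rule sum_mset_replicate_sum[OF finZ[OF that]])
  have setA: "set_mset (A x) = Z x" if x: "x \<in> ball 0 r" for x
    unfolding A_def using finZ[OF x] zpos[OF x] by (force simp: set_mset_sum)
  have holA: "(\<lambda>x. \<Sum>a\<in>#A x. h (x, a)) holomorphic_on ball 0 r" if h: "hol2 ?D h" for h
  proof -
    let ?H = "\<lambda>x w. pd2 F (x, w) * h (x, w) / F (x, w)"
    have Fnz: "F (x, w) \<noteq> 0" if "x \<in> ball 0 r" "w \<in> sphere 0 s" for x w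
      using small[OF that(1), of w] that s by (auto simp: Z_def)
    have subD: "ball 0 r \<times> sphere 0 s \<subseteq> ?D" using s by auto
    note cont = continuous_on_subset[OF hol2_continuous_on subD]
    have pd: "hol2 ?D (pd2 F)" by (rule hol2_pd2[OF oD hol])
    have "(\<lambda>x. contour_integral (circlepath 0 s) (?H x)) holomorphic_on ball 0 r"
    proof (rule holomorphic_circle_integral)
      show "continuous_on (ball 0 r \<times> sphere 0 s) (\<lambda>(x, w). ?H x w)"
        unfolding case_prod_unfold prod.collapse
        by (intro continuous_intros cont hol h pd) (use Fnz in auto)
      show "(\<lambda>x. ?H x w) holomorphic_on ball 0 r" if "w \<in> sphere 0 s" for w
        by (intro holomorphic_intros slice(2)[OF _ centre_in_ball[THEN iffD2]] h pd hol \<open>0 < r\<close> Fnz)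
          (use s that in auto)
    qed (use s in auto)
    then have "(\<lambda>x. 1 / (2 * pi * \<i>) * contour_integral (circlepath 0 s) (?H x)) holomorphic_on ball 0 r"
      by (intro holomorphic_intros)
    then show ?thesis
    proof (rule holomorphic_transform)
      fix x assume x: "x \<in> ball (0::complex) r"
      have pz: "{w \<in> ball 0 R. F (x, w) = 0 \<or> w \<in> {}} = Z x" by (auto simp: Z_def)
      have img: "path_image (circlepath 0 s) = sphere (0::complex) s"
        using s by (intro path_image_circlepath_nonneg) auto
      have hx: "(\<lambda>t. h (x, t)) holomorphic_on ball 0 R"
        using slice(1)[OF h x, of 0] \<open>0 < R\<close> by simp
      have "contour_integral (circlepath 0 s) (\<lambda>w. deriv (\<lambda>t. F (x, t)) w * h (x, w) / F (x, w))
          = 2 * pi * \<i> * (\<Sum>p\<in>{w \<in> ball 0 R. F (x, w) = 0 \<or> w \<in> {}}.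
              winding_number (circlepath 0 s) p * h (x, p) * zorder (\<lambda>t. F (x, t)) p)"
      proof (rule argument_principle)
        show "\<forall>z. z \<notin> ball 0 R \<longrightarrow> winding_number (circlepath 0 s) z = 0"
        proof -
          have "path_image (circlepath 0 s) \<subseteq> ball 0 R" unfolding img using s by auto
          then show ?thesis using winding_number_zero_outside[of "circlepath 0 s" "ball 0 R"] by simp
        qed
        show "path_image (circlepath 0 s) \<subseteq> ball 0 R - {w \<in> ball 0 R. F (x, w) = 0 \<or> w \<in> {}}"
          unfolding img pz using Fnz[OF x] s by (auto simp: Z_def)
      qed (use Fx[OF x] hx finZ[OF x] pz in auto)
      also have "(\<Sum>p\<in>{w \<in> ball 0 R. F (x, w) = 0 \<or> w \<in> {}}.
              winding_number (circlepath 0 s) p * h (x, p) * zorder (\<lambda>t. F (x, t)) p)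
          = (\<Sum>a\<in>#A x. h (x, a))"
        unfolding pz sumA[OF x]
      proof (rule sum.cong[OF refl])
        fix p assume p: "p \<in> Z x"
        have "winding_number (circlepath 0 s) p = 1"
          by (rule winding_number_circlepath) (use small[OF x p] in simp)
        then show "winding_number (circlepath 0 s) p * h (x, p) * zorder (\<lambda>t. F (x, t)) p
            = of_nat (nat (zorder (\<lambda>t. F (x, t)) p)) * h (x, p)"
          using zpos[OF x p] by simp
      qed
      finally show "1 / (2 * pi * \<i>) * contour_integral (circlepath 0 s) (?H x) = (\<Sum>a\<in>#A x. h (x, a))"
        by (simp add: pd2_def)
    qed
  qed
  have size0: "size (A 0) = n"
  proof (cases "n = 0")
    case True
    then have "Z 0 = {}" using g by (auto simp: Z_def)
    then show ?thesis using True by (simp add: A_def)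
  next
    case False
    then have "Z 0 = {0}" using g \<open>0 < R\<close> by (auto simp: Z_def)
    moreover have "zorder (\<lambda>t. F (0, t)) 0 = int n"
      by (rule zorder_eqI[of "ball 0 R" _ g]) (use g \<open>0 < R\<close> in \<open>auto simp: mult.commute\<close>)
    ultimately show ?thesis by (simp add: A_def)
  qed
  have "(\<lambda>x. \<Sum>a\<in>#A x. 1) holomorphic_on ball 0 r"
    by (rule holA[OF hol2_const])
  then have "(\<lambda>x. of_nat (size (A x)) :: complex) holomorphic_on ball 0 r" by simp
  then have "(\<lambda>x. of_nat (size (A x)) :: complex) constant_on ball 0 r"
  proof (intro continuous_discrete_range_constant connected_ball holomorphic_on_imp_continuous_on)
    fix x :: complex
    show "\<exists>e>0. \<forall>y. y \<in> ball 0 r \<and> of_nat (size (A y)) \<noteq> (of_nat (size (A x)) :: complex)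
        \<longrightarrow> e \<le> cmod (of_nat (size (A y)) - of_nat (size (A x)))"
    proof (intro exI[of _ 1] conjI allI impI)
      fix y assume "y \<in> ball 0 r \<and> of_nat (size (A y)) \<noteq> (of_nat (size (A x)) :: complex)"
      then have "1 \<le> \<bar>int (size (A y)) - int (size (A x))\<bar>" by auto
      also have "real_of_int \<dots> = cmod (of_int (int (size (A y)) - int (size (A x))))"
        by (simp only: norm_of_int of_int_abs)
      finally show "1 \<le> cmod (of_nat (size (A y)) - of_nat (size (A x)))" by simp
    qed simp
  qed
  then obtain c where c: "\<And>x. x \<in> ball 0 r \<Longrightarrow> of_nat (size (A x)) = (c::complex)"
    unfolding constant_on_def by blast
  have sizeA: "size (A x) = n" if "x \<in> ball 0 r" for x
  proof -
    have "of_nat (size (A x)) = (of_nat (size (A 0)) :: complex)"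
      using c[OF that] c[of 0] \<open>0 < r\<close> by simp
    then show ?thesis using size0 by (simp only: of_nat_eq_iff)
  qed
  show thesis
    by (rule that[of A]) (use sizeA setA holA in \<open>auto simp: Z_def\<close>)
qed

text \<open>The monic polynomial with the roots of \<open>F (x, _)\<close>, expanded around the mean \<open>m x\<close> of the roots.
Its coefficients are holomorphic because the power sums of the shifted roots are. Expanding
around the mean makes the coefficient \<open>c 1\<close> vanish.\<close>

lemma weierstrass_polynomial:
  assumes hol: "hol2 (ball 0 r \<times> ball 0 R) F" and "0 < r" "0 < R" "0 < K" "K * r < R"
    and zeros: "\<And>x y. x \<in> ball 0 r \<Longrightarrow> y \<in> ball 0 R \<Longrightarrow> F (x, y) = 0 \<Longrightarrow> cmod y \<le> K * cmod x"
    and g: "g holomorphic_on ball 0 R" "\<And>y. y \<in> ball 0 R \<Longrightarrow> g y \<noteq> 0"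
      "\<And>y. y \<in> ball 0 R \<Longrightarrow> F (0, y) = y ^ n * g y"
  obtains A m c where
    "\<And>x. x \<in> ball 0 r \<Longrightarrow> size (A x) = n"
    "\<And>x. x \<in> ball 0 r \<Longrightarrow> set_mset (A x) = {y \<in> ball 0 R. F (x, y) = 0}"
    "m holomorphic_on ball 0 r"
    "\<And>x y. x \<in> ball 0 r \<Longrightarrow> (\<Prod>a\<in>#A x. y - a) = (\<Sum>k\<le>n. c k x * (y - m x) ^ (n - k))"
    "\<And>x. x \<in> ball 0 r \<Longrightarrow> (\<Sum>a\<in>#A x. a - m x) = 0"
    "\<And>x. x \<in> ball 0 r \<Longrightarrow> cmod (m x) \<le> K * cmod x"
    "\<And>k. c k holomorphic_on ball 0 r" "\<And>x. c 0 x = 1" "\<And>x. x \<in> ball 0 r \<Longrightarrow> c 1 x = 0"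
    "\<And>x k \<rho>. x \<in> ball 0 r \<Longrightarrow> 0 \<le> \<rho> \<Longrightarrow> \<forall>a\<in>#A x. cmod (a - m x) \<le> \<rho>
        \<Longrightarrow> cmod (c k x) \<le> 2 ^ n * \<rho> ^ k"
proof -
  obtain A where A: "\<And>x. x \<in> ball 0 r \<Longrightarrow> size (A x) = n"
    "\<And>x. x \<in> ball 0 r \<Longrightarrow> set_mset (A x) = {y \<in> ball 0 R. F (x, y) = 0}"
    and holA: "\<And>h. hol2 (ball 0 r \<times> ball 0 R) h \<Longrightarrow> (\<lambda>x. \<Sum>a\<in>#A x. h (x, a)) holomorphic_on ball 0 r"
    by (rule roots_multiset[OF assms]) (assumption+, rule that)
  define m where "m = (\<lambda>x. (\<Sum>a\<in>#A x. a) / of_nat n)"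
  define B where "B = (\<lambda>x. image_mset (\<lambda>a. a - m x) (A x))"
  define c where "c = (\<lambda>k x. fps_nth (rev_poly (B x)) k)"
  have m: "m holomorphic_on ball 0 r"
  proof (cases "n = 0")
    case False
    have "(\<lambda>x. \<Sum>a\<in>#A x. a) holomorphic_on ball 0 r" using holA[OF hol2_snd] by simp
    then show ?thesis unfolding m_def using False by (intro holomorphic_intros) auto
  qed (simp add: m_def)
  have sum_diff: "(\<Sum>a\<in>#M. a - z) = (\<Sum>a\<in>#M. a) - of_nat (size M) * z" for M and z :: complex
    by (induction M) (auto simp: algebra_simps)
  have mean: "(\<Sum>a\<in>#A x. a - m x) = 0" if x: "x \<in> ball 0 r" for x
  proof (cases "n = 0")
    case True
    then show ?thesis using A(1)[OF x] by simp
  next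
    case False
    then show ?thesis using A(1)[OF x] unfolding sum_diff by (simp add: m_def)
  qed
  have norm_sum: "cmod (\<Sum>a\<in>#M. a) \<le> of_nat (size M) * \<rho>"
    if "\<And>a. a \<in># M \<Longrightarrow> cmod a \<le> \<rho>" for M and \<rho> :: real
    using that
  proof (induction M)
    case (add a M)
    have "cmod (\<Sum>a\<in>#add_mset a M. a) \<le> cmod a + cmod (\<Sum>a\<in>#M. a)"
      by (simp add: norm_triangle_ineq)
    also have "\<dots> \<le> \<rho> + of_nat (size M) * \<rho>" using add by (intro add_mono) auto
    finally show ?case by (simp add: algebra_simps)
  qed simp
  have m_le: "cmod (m x) \<le> K * cmod x" if x: "x \<in> ball 0 r" for x
  proof (cases "n = 0")
    case False
    have "cmod (\<Sum>a\<in>#A x. a) \<le> of_nat n * (K * cmod x)"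
      using norm_sum[of "A x" "K * cmod x"] A[OF x] zeros[OF x] by auto
    then show ?thesis
      using False by (simp add: m_def norm_divide field_simps)
  qed (use \<open>0 < K\<close> in \<open>simp add: m_def\<close>)
  have pow: "(\<lambda>x. \<Sum>a\<in>#B x. a ^ Suc j) holomorphic_on ball 0 r" for j
  proof -
    have "hol2 (ball 0 r \<times> ball 0 R) (\<lambda>z. (snd z - m (fst z)) ^ Suc j)"
      by (intro hol2_power hol2_diff hol2_snd hol2_compose[OF m open_ball hol2_fst]) auto
    from holA[OF this] show ?thesis by (simp add: B_def image_mset.compositionality o_def)
  qed
  have c1: "c 1 x = 0" if "x \<in> ball 0 r" for x
    using newton_identity[of 0 "B x"] mean[OF that] by (simp add: c_def B_def)
  show thesis
  proof (rule that[of A m c])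
    show "c k holomorphic_on ball 0 r" for k
      unfolding c_def by (rule holomorphic_rev_poly_nth[OF pow])
    show "(\<Prod>a\<in>#A x. y - a) = (\<Sum>k\<le>n. c k x * (y - m x) ^ (n - k))" if x: "x \<in> ball 0 r" for x y
      using prod_mset_eq_rev_poly[of "y - m x" "B x"] A(1)[OF x]
      by (simp add: c_def B_def image_mset.compositionality o_def)
    show "cmod (c k x) \<le> 2 ^ n * \<rho> ^ k"
      if "x \<in> ball 0 r" "0 \<le> \<rho>" "\<forall>a\<in>#A x. cmod (a - m x) \<le> \<rho>" for x k \<rho>
      using norm_rev_poly_nth_le[of "B x" \<rho> k] that A(1) by (auto simp: c_def B_def)
  qed (use A m mean m_le c1 in \<open>simp_all add: c_def\<close>)
qed

section \<open>Local equations of reduced curves\<close>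

lemma local_equationD:
  assumes "local_equation Y U f"
  shows "open U" "hol2 U f" "Y \<inter> U = {z \<in> U. f z = 0}"
proof -
  note * = assms[unfolded local_equation_def]
  show "open U" "hol2 U f" "Y \<inter> U = {z \<in> U. f z = 0}"
    by (fact conjunct1[OF *] conjunct1[OF conjunct2[OF *]] conjunct1[OF conjunct2[OF conjunct2[OF *]]])+
qed

lemma local_equation_factor:
  assumes "local_equation Y U f" "open V" "V \<subseteq> U" "hol2 V g" "\<And>z. z \<in> Y \<inter> V \<Longrightarrow> g z = 0"
  obtains h where "hol2 V h" "\<And>z. z \<in> V \<Longrightarrow> g z = f z * h z"
proof -
  have "\<forall>V g. open V \<and> V \<subseteq> U \<and> hol2 V g \<and> (\<forall>z\<in>Y \<inter> V. g z = 0) \<longrightarrow>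
        (\<exists>h. hol2 V h \<and> (\<forall>z\<in>V. g z = f z * h z))"
    using assms(1) unfolding local_equation_def by (elim conjE)
  from this[THEN spec, THEN spec, of V g] assms(2-5)
  obtain h where "hol2 V h \<and> (\<forall>z\<in>V. g z = f z * h z)" by auto
  then show thesis using that[of h] by simp
qed

lemma local_equationI:
  assumes "open U" "hol2 U f" "Y \<inter> U = {z \<in> U. f z = 0}"
    and "\<And>V g. open V \<Longrightarrow> V \<subseteq> U \<Longrightarrow> hol2 V g \<Longrightarrow> (\<And>z. z \<in> Y \<inter> V \<Longrightarrow> g z = 0)
        \<Longrightarrow> \<exists>h. hol2 V h \<and> (\<forall>z\<in>V. g z = f z * h z)"
  shows "local_equation Y U f"
  unfolding local_equation_def
proof (intro conjI allI impI assms(1-3))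
  fix V g assume "open V \<and> V \<subseteq> U \<and> hol2 V g \<and> (\<forall>z\<in>Y \<inter> V. g z = 0)"
  then show "\<exists>h. hol2 V h \<and> (\<forall>z\<in>V. g z = f z * h z)"
    by (elim conjE) (rule assms(4), assumption+, erule bspec)
qed

lemma local_equation_subset:
  assumes f: "local_equation Y U f" and V: "open V" "V \<subseteq> U"
  shows "local_equation Y V f"
proof (rule local_equationI[OF V(1)])
  show "hol2 V f" by (rule hol2_subset[OF local_equationD(2)[OF f] V(2)])
  show "Y \<inter> V = {z \<in> V. f z = 0}" using local_equationD(3)[OF f] V(2) by blast
  fix N g assume N: "open N" "N \<subseteq> V" "hol2 N g" "\<And>z. z \<in> Y \<inter> N \<Longrightarrow> g z = 0"
  obtain h where "hol2 N h" "\<And>z. z \<in> N \<Longrightarrow> g z = f z * h z"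
    by (rule local_equation_factor[OF f N(1) subset_trans[OF N(2) V(2)] N(3,4)]) (assumption, rule that)
  then show "\<exists>h. hol2 N h \<and> (\<forall>z\<in>N. g z = f z * h z)" by (intro exI[of _ h]) simp
qed

lemma local_equation_times_unit:
  assumes f: "local_equation Y U f" and h: "hol2 U h" "\<And>z. z \<in> U \<Longrightarrow> h z \<noteq> 0"
    and g: "\<And>z. z \<in> U \<Longrightarrow> g z = f z * h z"
  shows "local_equation Y U g"
proof (rule local_equationI)
  note U = local_equationD[OF f]
  show "open U" by (rule U(1))
  show "hol2 U g" by (rule hol2_cong[OF U(1) hol2_mult[OF U(2) h(1)]]) (simp add: g)
  show "Y \<inter> U = {z \<in> U. g z = 0}" unfolding U(3) using g h(2) by auto
  fix V u assume V: "open V" "V \<subseteq> U" "hol2 V u" "\<And>z. z \<in> Y \<inter> V \<Longrightarrow> u z = 0"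
  obtain k where k: "hol2 V k" "\<And>z. z \<in> V \<Longrightarrow> u z = f z * k z"
    by (rule local_equation_factor[OF f V]) (assumption, rule that)
  have "hol2 V (\<lambda>z. k z / h z)"
    by (rule hol2_divide[OF k(1) hol2_subset[OF h(1) V(2)]]) (rule h(2)[OF subsetD[OF V(2)]])
  moreover have "u z = g z * (k z / h z)" if "z \<in> V" for z
    using k(2)[OF that] g[of z] h(2)[of z] subsetD[OF V(2) that] by simp
  ultimately show "\<exists>k. hol2 V k \<and> (\<forall>z\<in>V. u z = g z * k z)"
    by (intro exI[of _ "\<lambda>z. k z / h z"]) simp
qed

lemma eq_off_curve:
  fixes F H :: "complex \<times> complex \<Rightarrow> complex"
  assumes "interior Y = {}" "open V" "continuous_on V F" "continuous_on V H"
    and "\<And>z. z \<in> V - Y \<Longrightarrow> F z = H z" "z \<in> V"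
  shows "F z = H z"
proof -
  let ?D = "V \<inter> (\<lambda>z. F z - H z) -` (- {0})"
  have "open ?D"
    by (rule continuous_open_preimage[OF continuous_on_diff[OF assms(3,4)] assms(2) open_Compl[OF closed_singleton]])
  moreover have "?D \<subseteq> Y" using assms(5) by auto
  ultimately have "?D \<subseteq> interior Y" by (rule interior_maximal[rotated])
  then show ?thesis using assms(1,6) by auto
qed

text \<open>If the differential of \<open>f\<close> vanished on \<open>Y\<close> near \<open>q\<close>, then reducedness would give \<open>df = f \<kappa>\<close> with a
holomorphic form \<open>\<kappa>\<close>. Along every line through \<open>q\<close> this is a linear differential equation with
initial value \<open>f q = 0\<close>, so \<open>f\<close> would vanish near \<open>q\<close> and \<open>Y\<close> would have interior points.\<close>

lemma nonsingular_points_dense: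
  assumes f: "local_equation Y U f" and int: "interior Y = {}" and "q \<in> Y" "q \<in> U" "open N" "q \<in> N"
  shows "\<exists>z\<in>Y \<inter> U \<inter> N. pd1 f z \<noteq> 0 \<or> pd2 f z \<noteq> 0"
proof (rule ccontr)
  assume none: "\<not> ?thesis"
  note U = local_equationD[OF f]
  have "open (U \<inter> N)" "q \<in> U \<inter> N" using U assms by auto
  then obtain \<rho> where \<rho>: "0 < \<rho>" "ball q \<rho> \<subseteq> U \<inter> N" using open_contains_ball by metis
  have sub: "ball q \<rho> \<subseteq> U" using \<rho> by blast
  note hol = hol2_subset[OF U(2) sub]
  have van: "pd1 f z = 0 \<and> pd2 f z = 0" if "z \<in> Y \<inter> ball q \<rho>" for z
    using none that \<rho>(2) by blast
  obtain k1 where k1: "hol2 (ball q \<rho>) k1" "\<And>z. z \<in> ball q \<rho> \<Longrightarrow> pd1 f z = f z * k1 z"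
    by (rule local_equation_factor[OF f open_ball sub hol2_pd1[OF open_ball hol]]) (simp add: van, rule that)
  obtain k2 where k2: "hol2 (ball q \<rho>) k2" "\<And>z. z \<in> ball q \<rho> \<Longrightarrow> pd2 f z = f z * k2 z"
    by (rule local_equation_factor[OF f open_ball sub hol2_pd2[OF open_ball hol]]) (simp add: van, rule that)
  have "f z = 0" if z: "z \<in> ball q \<rho>" for z
  proof -
    obtain w s where w: "norm w < 1" "s \<in> ball 0 \<rho>" "frame_pt q 0 w (0, s) = z"
      by (rule ball_on_line[OF z])
    let ?l = "\<lambda>t. frame_pt q 0 w (0, t)" and ?\<kappa> = "\<lambda>z. k1 z * fst w + k2 z * snd w"
    have mem: "?l t \<in> ball q \<rho>" if "t \<in> ball 0 \<rho>" for t
    proof -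
      have "cmod t * norm w \<le> cmod t * 1" using w(1) by (intro mult_left_mono) auto
      with dist_frame_pt[of q 0 w "(0, t)"] that show ?thesis by auto
    qed
    have "hol2 (ball q \<rho>) ?\<kappa>" by (intro hol2_intros k1 k2)
    from holomorphic_on_line[OF this w(1), of 0]
    have "(\<lambda>t. ?\<kappa> (?l t)) holomorphic_on ball 0 \<rho>" .
    then obtain L where L: "\<And>t. t \<in> ball 0 \<rho> \<Longrightarrow> (L has_field_derivative ?\<kappa> (?l t)) (at t within ball 0 \<rho>)"
      using holomorphic_convex_primitive'[OF convex_ball open_ball] by blast
    \<comment> \<open>The integrating factor \<open>exp (- L)\<close>, where \<open>L' = \<kappa>\<close>, turns the solution into a constant.\<close>
    have "\<exists>c. \<forall>t\<in>ball 0 \<rho>. f (?l t) * exp (- L t) = c"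
    proof (rule has_field_derivative_zero_constant[OF convex_ball])
      fix t :: complex assume t: "t \<in> ball 0 \<rho>"
      have l: "(?l has_derivative (\<lambda>h. (h * fst w, h * snd w))) (at t)"
        unfolding frame_pt_def by (auto intro!: derivative_eq_intros)
      have "((\<lambda>t. f (?l t)) has_field_derivative f (?l t) * ?\<kappa> (?l t)) (at t)"
        unfolding has_field_derivative_def
        by (rule has_derivative_eq_rhs[OF has_derivative_compose[OF l hol2_has_derivative[OF hol mem[OF t]]]])
          (simp add: fun_eq_iff k1(2)[OF mem[OF t]] k2(2)[OF mem[OF t]] algebra_simps)
      from DERIV_mult[OF has_field_derivative_at_within[OF this]
          DERIV_chain2[OF DERIV_exp DERIV_minus[OF L[OF t]]]]
      show "((\<lambda>t. f (?l t) * exp (- L t)) has_field_derivative 0) (at t within ball 0 \<rho>)"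
        by (simp add: algebra_simps)
    qed
    then obtain c where c: "\<And>t. t \<in> ball 0 \<rho> \<Longrightarrow> f (?l t) * exp (- L t) = c" by blast
    have "?l 0 = q" by (simp add: frame_pt_def)
    then have "c = 0" using c[of 0] \<rho>(1) assms(3,4) U(3) by auto
    then show ?thesis using c[OF w(2)] w(3) by simp
  qed
  then have "ball q \<rho> \<subseteq> Y" using U(3) sub by blast
  then have "ball q \<rho> \<subseteq> interior Y" by (rule interior_maximal) simp
  then show False using int \<rho>(1) by auto
qed

section \<open>Residues of logarithmic forms\<close>

text \<open>The form \<open>\<omega> = (a dx + b dy) / f\<close> satisfies
\<open>f d\<omega> = d (a dx + b dy) - (df / f) \<and> (a dx + b dy)\<close>, so that it is logarithmic as soon as \<open>f\<close> divides
\<open>df \<and> (a dx + b dy)\<close>.\<close>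

lemma logarithmic_form_germ:
  assumes f: "local_equation Y V f" and p: "p \<in> V" "V \<subseteq> G"
    and hol: "hol2 V a" "hol2 V b" "hol2 V c"
    and log: "\<And>z. z \<in> V \<Longrightarrow> pd1 f z * b z - pd2 f z * a z = f z * c z"
  shows "(V, \<lambda>z. (a z / f z, b z / f z)) \<in> log_germs G Y p"
proof -
  let ?\<omega> = "\<lambda>z. (a z / f z, b z / f z)"
  note V = local_equationD[OF f]
  have nz: "f z \<noteq> 0" if "z \<in> V - Y" for z using V(3) that by blast
  have "V - Y = V \<inter> f -` (- {0})" using V(3) by blast
  then have oVY: "open (V - Y)"
    using continuous_open_preimage[OF hol2_continuous_on[OF V(2)] V(1) open_Compl[OF closed_singleton[of 0]]]
    by simp
  have q: "hol2 (V - Y) (\<lambda>z. g z / f z)" if "hol2 V g" for g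
    by (intro hol2_divide nz hol2_subset[OF that] hol2_subset[OF V(2)]) auto
  have m: "mero 1 Y V (\<lambda>z. g z / f z)" if "hol2 V g" for g
    unfolding mero_def
  proof (intro conjI ballI q[OF that] exI)
    fix u assume "u \<in> V"
    then show "u \<in> V" .
    show "V \<subseteq> V" "local_equation Y V f" "hol2 V g" by (fact order_refl f that)+
    show "f z ^ 1 * (g z / f z) = g z" if "z \<in> V - Y" for z using nz[OF that] by simp
  qed
  have d: "f z * d1 ?\<omega> z = pd1 b z - pd2 a z - c z" if z: "z \<in> V - Y" for z
  proof -
    have zV: "z \<in> V" using z by blast
    have "pd1 (\<lambda>z. b z / f z) z = (pd1 b z * f z - b z * pd1 f z) / (f z)^2"
      "pd2 (\<lambda>z. a z / f z) z = (pd2 a z * f z - a z * pd2 f z) / (f z)^2"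
      by (fact has_pds_eq(1)[OF has_pds_divide[OF has_pds_pd[OF hol(2) zV] has_pds_pd[OF V(2) zV] nz[OF z]]]
          has_pds_eq(2)[OF has_pds_divide[OF has_pds_pd[OF hol(1) zV] has_pds_pd[OF V(2) zV] nz[OF z]]])+
    then have dd: "d1 ?\<omega> z = (f z * (pd1 b z - pd2 a z) - (pd1 f z * b z - pd2 f z * a z)) / (f z)^2"
      by (simp add: d1_def diff_divide_distrib[symmetric] algebra_simps)
    have "f z * ((f z * u - f z * w) / (f z)^2) = u - w" for u w
      using nz[OF z] by (simp add: power2_eq_square right_diff_distrib[symmetric])
    then show ?thesis unfolding dd log[OF zV] .
  qed
  have "mero 1 Y V (d1 ?\<omega>)"
    unfolding mero_def
  proof (intro conjI ballI exI)
    show "hol2 (V - Y) (d1 ?\<omega>)"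
      unfolding d1_def fst_conv snd_conv
      by (intro hol2_diff hol2_pd1 hol2_pd2 oVY q hol)
    fix u assume "u \<in> V"
    then show "u \<in> V" .
    show "V \<subseteq> V" "local_equation Y V f" by (fact order_refl f)+
    show "hol2 V (\<lambda>z. pd1 b z - pd2 a z - c z)"
      by (intro hol2_diff hol2_pd1 hol2_pd2 V(1) hol)
    show "f z ^ 1 * d1 ?\<omega> z = pd1 b z - pd2 a z - c z" if "z \<in> V - Y" for z
      using d[OF that] by simp
  qed
  then show ?thesis
    using V(1) p m[OF hol(1)] m[OF hol(2)]
    unfolding log_germs_def Omega1_log_def Omega1_def Omega2_def by simp
qed

text \<open>The defining property of the residue \<open>\<phi>\<close> involves some local equation \<open>f' = f / k\<close> and some
extension \<open>g\<close> of \<open>\<phi>\<close>. Multiplied by \<open>f\<close>, the relation \<open>\<omega> - g df' / f' = \<eta>\<close> extends continuously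
over \<open>Y\<close> and reads \<open>a dx + b dy = g k df' = \<phi> df\<close> there.\<close>

lemma has_residue_at_regular_point:
  assumes int: "interior Y = {}" and f: "local_equation Y V f" and hol: "hol2 V a" "hol2 V b"
    and res: "has_residue Y W (\<lambda>z. (a z / f z, b z / f z)) \<phi>" and "W \<subseteq> V"
    and q: "q \<in> Y" "q \<in> W" "pd1 f q \<noteq> 0 \<or> pd2 f q \<noteq> 0"
  shows "a q = \<phi> q * pd1 f q" "b q = \<phi> q * pd2 f q"
proof -
  note V = local_equationD[OF f]
  have qV: "q \<in> V" using q \<open>W \<subseteq> V\<close> by blast
  have "q \<in> regular_locus Y \<inter> W"
    unfolding regular_locus_def using V q qV by blast
  from bspec[OF res[unfolded has_residue_def] this]
  obtain N f' g where N0: "q \<in> N \<and> N \<subseteq> W \<and> local_equation Y N f' \<and> hol2 N g \<and>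
      (\<forall>z\<in>Y \<inter> N. g z = \<phi> z) \<and>
      (\<lambda>z. (fst (a z / f z, b z / f z) - g z * (fst (d0 f' z) / f' z),
            snd (a z / f z, b z / f z) - g z * (snd (d0 f' z) / f' z))) \<in> Omega1 0 Y N"
    by (elim exE) (rule that)
  then have N: "q \<in> N" "N \<subseteq> W" "local_equation Y N f'" "hol2 N g" "\<forall>z\<in>Y \<inter> N. g z = \<phi> z"
    "mero 0 Y N (\<lambda>z. a z / f z - g z * (pd1 f' z / f' z))"
    "mero 0 Y N (\<lambda>z. b z / f z - g z * (pd2 f' z / f' z))"
    unfolding Omega1_def d0_def by simp_all
  note f' = local_equationD[OF N(3)]
  have NV: "N \<subseteq> V" using N(2) \<open>W \<subseteq> V\<close> by blast
  obtain k where k: "hol2 N k" "\<And>z. z \<in> N \<Longrightarrow> f z = f' z * k z"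
  proof (rule local_equation_factor[OF N(3) f'(1) order_refl hol2_subset[OF V(2) NV]])
    show "f z = 0" if "z \<in> Y \<inter> N" for z using V(3) NV that by blast
  qed (rule that)
  have f0: "f q = 0" "f' q = 0" using V(3) f'(3) q qV N(1) by auto
  have hp: "has_pds f q (pd1 f' q * k q) (pd2 f' q * k q)"
  proof -
    have "has_pds (\<lambda>z. f' z * k z) q (pd1 f' q * k q) (pd2 f' q * k q)"
      using has_pds_mult[OF has_pds_pd[OF f'(2) N(1)] has_pds_pd[OF k(1) N(1)]] f0 by simp
    moreover have "((\<lambda>z. f' z * k z) has_derivative D) (at q) \<Longrightarrow> (f has_derivative D) (at q)" for D
      by (erule has_derivative_transform_within_open[OF _ f'(1) N(1)]) (simp add: k(2))
    ultimately show ?thesis unfolding has_pds_def by blast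
  qed
  have key: "u q = g q * k q * d q"
    if u: "hol2 V u" and d: "hol2 N d" and m: "mero 0 Y N (\<lambda>z. u z / f z - g z * (d z / f' z))" for u d
  proof -
    from bspec[OF conjunct2[OF m[unfolded mero_def]] N(1)]
    obtain M f1 h where M0: "q \<in> M \<and> M \<subseteq> N \<and> local_equation Y M f1 \<and> hol2 M h \<and>
        (\<forall>z\<in>M - Y. f1 z ^ 0 * (u z / f z - g z * (d z / f' z)) = h z)"
      by (elim exE) (rule that)
    then have M: "q \<in> M" "M \<subseteq> N" "open M" "hol2 M h"
      "\<And>z. z \<in> M - Y \<Longrightarrow> u z / f z - g z * (d z / f' z) = h z"
      using local_equationD(1)[of Y M f1] by simp_all
    have "u q = g q * k q * d q + f q * h q"
    proof (rule eq_off_curve[OF int M(3) _ _ _ M(1)])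
      show "continuous_on M u" "continuous_on M (\<lambda>z. g z * k z * d z + f z * h z)"
        using M(2) NV
        by (intro hol2_continuous_on hol2_intros hol2_subset[OF u] hol2_subset[OF N(4)]
            hol2_subset[OF k(1)] hol2_subset[OF d] hol2_subset[OF V(2)] M(4); blast)+
      fix z assume z: "z \<in> M - Y"
      then have "f z \<noteq> 0" "f' z \<noteq> 0" "f z = f' z * k z" using V(3) f'(3) M(2) NV k(2) by blast+
      then show "u z = g z * k z * d z + f z * h z"
        unfolding M(5)[OF z, symmetric] by (simp add: field_simps)
    qed
    then show ?thesis using f0 by simp
  qed
  have "g q = \<phi> q" using N(1,5) q by blast
  then show "a q = \<phi> q * pd1 f q" "b q = \<phi> q * pd2 f q"
    using key[OF hol(1) hol2_pd1[OF f'(1,2)] N(6)] key[OF hol(2) hol2_pd2[OF f'(1,2)] N(7)]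
      has_pds_eq[OF hp] by (simp_all add: mult.commute mult.left_commute)
qed

text \<open>This is what the hypothesis on the curve is used for: the class of a logarithmic form is the image
of a germ of a continuous function, which is then the residue of the form itself.\<close>

lemma logarithmic_form_residue_continuous:
  assumes eq: "plane_weak_norm_eq_omega0 G Y" and int: "interior Y = {}"
    and f: "local_equation Y V f" and p: "p \<in> Y" "p \<in> V" "V \<subseteq> G"
    and hol: "hol2 V a" "hol2 V b" "hol2 V c"
    and log: "\<And>z. z \<in> V \<Longrightarrow> pd1 f z * b z - pd2 f z * a z = f z * c z"
  obtains N \<phi> where "open N" "p \<in> N" "N \<subseteq> V" "continuous_on (Y \<inter> N) \<phi>"
    "\<And>q. q \<in> Y \<inter> N \<Longrightarrow> pd1 f q \<noteq> 0 \<or> pd2 f q \<noteq> 0 \<Longrightarrow> a q = \<phi> q * pd1 f q \<and> b q = \<phi> q * pd2 f q"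
proof -
  let ?\<omega> = "\<lambda>z. (a z / f z, b z / f z)"
  have germ: "(V, ?\<omega>) \<in> log_germs G Y p" by (rule logarithmic_form_germ[OF f p(2,3) hol log])
  note oV = local_equationD(1)[OF f]
  have "mero 0 Y V (\<lambda>z. 0)"
    unfolding mero_def using f hol2_const[of _ 0] by auto
  then have "(\<lambda>z. ?\<omega> z - ?\<omega> z) \<in> Omega1 0 Y V" unfolding Omega1_def by simp
  then have refl: "((V, ?\<omega>), (V, ?\<omega>)) \<in> log_rel G Y p"
    using germ oV p unfolding log_rel_def by blast
  have "log_rel G Y p `` {(V, ?\<omega>)} \<in> omega0_stalk G Y p"
    unfolding omega0_stalk_def by (rule quotientI[OF germ])
  then obtain u where u: "u \<in> weak_norm_germs G Y p" "log_rel G Y p `` {(V, ?\<omega>)} = residue_inj G Y p u"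
    using eq p(1) unfolding plane_weak_norm_eq_omega0_def by blast
  obtain U \<phi> where U: "u = (U, \<phi>)" by (cases u)
  have "(V, ?\<omega>) \<in> residue_inj G Y p (U, \<phi>)" using refl u(2) U by blast
  then obtain W where W: "open W" "p \<in> W" "W \<subseteq> U \<inter> V" "has_residue Y W ?\<omega> \<phi>" by auto
  have "continuous_on (Y \<inter> U) \<phi>" using u(1) U unfolding weak_norm_germs_def weak_norm_sections_def by blast
  then have "continuous_on (Y \<inter> W) \<phi>" by (rule continuous_on_subset) (use W(3) in blast)
  then show thesis
  proof (rule that[rotated 3])
    fix q assume q: "q \<in> Y \<inter> W" "pd1 f q \<noteq> 0 \<or> pd2 f q \<noteq> 0"
    have "W \<subseteq> V" using W(3) by blast
    from has_residue_at_regular_point[OF int f hol(1,2) W(4) this _ _ q(2)] q(1)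
    show "a q = \<phi> q * pd1 f q \<and> b q = \<phi> q * pd2 f q" by simp
  qed (use W in blast)+
qed

section \<open>Weierstrass charts\<close>

text \<open>The coordinates of \<open>z\<close> in the frame of \<open>frame_pt p e v\<close>, by Cramer's rule.\<close>

definition coord1 :: "complex \<times> complex \<Rightarrow> complex \<times> complex \<Rightarrow> complex \<times> complex \<Rightarrow> complex \<times> complex \<Rightarrow> complex" where
  "coord1 p e v z = ((fst z - fst p) * snd v - (snd z - snd p) * fst v) / (fst e * snd v - snd e * fst v)"

definition coord2 :: "complex \<times> complex \<Rightarrow> complex \<times> complex \<Rightarrow> complex \<times> complex \<Rightarrow> complex \<times> complex \<Rightarrow> complex" where
  "coord2 p e v z = (fst e * (snd z - snd p) - snd e * (fst z - fst p)) / (fst e * snd v - snd e * fst v)"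

lemma coord_frame_pt:
  assumes "fst e * snd v - snd e * fst v \<noteq> 0"
  shows "coord1 p e v (frame_pt p e v w) = fst w" "coord2 p e v (frame_pt p e v w) = snd w"
    "frame_pt p e v (coord1 p e v z, coord2 p e v z) = z"
proof -
  let ?J = "fst e * snd v - snd e * fst v"
  have "(fst w * fst e + snd w * fst v) * snd v - (fst w * snd e + snd w * snd v) * fst v = fst w * ?J"
    by (simp add: algebra_simps)
  then show "coord1 p e v (frame_pt p e v w) = fst w" using assms by (simp add: coord1_def frame_pt_def add.assoc)
  have "fst e * (fst w * snd e + snd w * snd v) - snd e * (fst w * fst e + snd w * fst v) = snd w * ?J"
    by (simp add: algebra_simps)
  then show "coord2 p e v (frame_pt p e v w) = snd w" using assms by (simp add: coord2_def frame_pt_def add.assoc)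
  define a b where "a = fst z - fst p" and "b = snd z - snd p"
  have "(a * snd v - b * fst v) * fst e + (fst e * b - snd e * a) * fst v = a * ?J"
    "(a * snd v - b * fst v) * snd e + (fst e * b - snd e * a) * snd v = b * ?J"
    by (simp_all add: algebra_simps)
  then have "((a * snd v - b * fst v) * fst e + (fst e * b - snd e * a) * fst v) / ?J = a"
    "((a * snd v - b * fst v) * snd e + (fst e * b - snd e * a) * snd v) / ?J = b"
    using assms by simp_all
  then have "(a * snd v - b * fst v) / ?J * fst e + (fst e * b - snd e * a) / ?J * fst v = a"
    "(a * snd v - b * fst v) / ?J * snd e + (fst e * b - snd e * a) / ?J * snd v = b"
    by (simp_all add: add_divide_distrib)
  then show "frame_pt p e v (coord1 p e v z, coord2 p e v z) = z"
    by (simp add: frame_pt_def coord1_def coord2_def prod_eq_iff add.assoc flip: a_def b_def) (simp add: a_def b_def)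
qed

lemma has_pds_coord:
  fixes p e v :: "complex \<times> complex"
  defines "J \<equiv> fst e * snd v - snd e * fst v"
  shows "has_pds (coord1 p e v) z (snd v / J) (- fst v / J)"
    "has_pds (coord2 p e v) z (- snd e / J) (fst e / J)"
  unfolding has_pds_def coord1_def[abs_def] coord2_def[abs_def] J_def
  by (auto intro!: derivative_eq_intros simp: fun_eq_iff divide_inverse algebra_simps)

lemma hol2_coord: "hol2 U (coord1 p e v)" "hol2 U (coord2 p e v)"
  unfolding hol2_iff using has_pds_coord by blast+

text \<open>A function that is divisible by \<open>x\<^sup>j\<close> and is \<open>o(x\<^sup>j)\<close> is divisible by one more power of \<open>x\<close>.\<close>

lemma holomorphic_order_gain:
  assumes "0 < r" "d holomorphic_on ball 0 r" "\<And>x. x \<in> ball 0 r \<Longrightarrow> h x = x ^ j * d x"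
    and small: "\<And>\<epsilon>. 0 < \<epsilon> \<Longrightarrow> \<epsilon> \<le> 1 \<Longrightarrow>
      \<exists>\<tau>>0. \<forall>x\<in>ball 0 r. cmod x < \<tau> \<longrightarrow> cmod (h x) \<le> C * \<epsilon> * cmod x ^ j"
  shows "\<exists>d'. d' holomorphic_on ball 0 r \<and> (\<forall>x\<in>ball 0 r. h x = x ^ Suc j * d' x)"
proof -
  have cont: "isCont d 0" by (rule holomorphic_isCont_centre[OF assms(2,1)])
  have "(d \<longlongrightarrow> 0) (at 0)"
  proof (rule tendstoI)
    fix \<eta> :: real assume \<eta>: "0 < \<eta>"
    define \<epsilon> where "\<epsilon> = min 1 (\<eta> / (\<bar>C\<bar> + 1))"
    have \<epsilon>: "0 < \<epsilon>" "\<epsilon> \<le> 1" using \<eta> by (auto simp: \<epsilon>_def)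
    have "\<epsilon> \<le> \<eta> / (\<bar>C\<bar> + 1)" by (simp add: \<epsilon>_def)
    then have "\<epsilon> * (\<bar>C\<bar> + 1) \<le> \<eta>" by (subst (asm) pos_le_divide_eq) auto
    then have "\<bar>C\<bar> * \<epsilon> + \<epsilon> \<le> \<eta>" by (simp add: algebra_simps)
    moreover have "C * \<epsilon> \<le> \<bar>C\<bar> * \<epsilon>" using \<epsilon> by (intro mult_right_mono) auto
    ultimately have C\<epsilon>: "C * \<epsilon> < \<eta>" using \<epsilon> by linarith
    obtain \<tau> where \<tau>: "0 < \<tau>" "\<And>x. x \<in> ball 0 r \<Longrightarrow> cmod x < \<tau> \<Longrightarrow> cmod (h x) \<le> C * \<epsilon> * cmod x ^ j"
      using small[OF \<epsilon>] by blast
    show "eventually (\<lambda>x. dist (d x) 0 < \<eta>) (at 0)"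
      unfolding eventually_at
    proof (intro exI[of _ "min \<tau> r"] conjI ballI impI)
      show "0 < min \<tau> r" using \<tau> assms(1) by simp
      fix x :: complex assume x: "x \<noteq> 0 \<and> dist x 0 < min \<tau> r"
      then have "cmod x ^ j * cmod (d x) \<le> C * \<epsilon> * cmod x ^ j"
        using \<tau>(2)[of x] assms(3)[of x] by (simp add: norm_mult norm_power)
      then have "cmod (d x) \<le> C * \<epsilon>" using x by (simp add: mult.commute[of "cmod x ^ j"])
      then show "dist (d x) 0 < \<eta>" using C\<epsilon> by simp
    qed
  qed
  then have "d 0 = 0"
    using cont tendsto_unique[OF trivial_limit_at] unfolding isCont_def by blast
  then obtain d' where d': "d' holomorphic_on ball 0 r" "\<And>x. x \<in> ball 0 r \<Longrightarrow> d x = x * d' x"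
    using holomorphic_factor_out_zero[OF assms(2)] by blast
  have "h x = x ^ Suc j * d' x" if "x \<in> ball 0 r" for x
    using assms(3)[OF that] d'(2)[OF that] by simp
  with d'(1) show ?thesis by blast
qed

text \<open>The negative of \<open>w\<close> is the average of the differences \<open>f a - w\<close>.\<close>

lemma centred_mset_shift_le:
  assumes "(\<Sum>a\<in>#M. f a) = (0::complex)" "\<And>a. a \<in># M \<Longrightarrow> cmod (f a - w) \<le> \<rho>" "M \<noteq> {#}"
  shows "cmod w \<le> \<rho>"
proof -
  have "cmod ((\<Sum>a\<in>#M. f a) - of_nat (size M) * w) \<le> of_nat (size M) * \<rho>"
    using assms(2)
  proof (induction M)
    case (add a M)
    have "(\<Sum>a\<in>#add_mset a M. f a) - of_nat (size (add_mset a M)) * w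
        = (f a - w) + ((\<Sum>a\<in>#M. f a) - of_nat (size M) * w)"
      by (simp add: algebra_simps)
    also have "cmod \<dots> \<le> cmod (f a - w) + cmod ((\<Sum>a\<in>#M. f a) - of_nat (size M) * w)"
      by (rule norm_triangle_ineq)
    also have "\<dots> \<le> \<rho> + of_nat (size M) * \<rho>" using add by (intro add_mono) auto
    finally show ?case by (simp add: algebra_simps)
  qed simp
  then have "of_nat (size M) * cmod w \<le> of_nat (size M) * \<rho>"
    unfolding assms(1) by (simp add: norm_mult)
  moreover have "0 < real (size M)" using assms(3) by (simp add: nonempty_has_size)
  ultimately show ?thesis by simp
qed

text \<open>Near its point \<open>p\<close> the curve \<open>Y\<close> is described by a Weierstrass polynomial in the coordinates of a
frame: \<open>A x\<close> are the \<open>n\<close> roots over \<open>x\<close>, \<open>m x\<close> is their mean and \<open>c k\<close> are the coefficients of the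
expansion around the mean. The bound \<open>A_le\<close> says that the vertical axis is not tangent to \<open>Y\<close>.\<close>

locale weierstrass_chart =
  fixes Y V :: "(complex \<times> complex) set" and p e v :: "complex \<times> complex"
    and r K :: real and n :: nat and A :: "complex \<Rightarrow> complex multiset"
    and m :: "complex \<Rightarrow> complex" and c :: "nat \<Rightarrow> complex \<Rightarrow> complex"
  assumes J: "fst e * snd v - snd e * fst v \<noteq> 0"
    and r_pos: "0 < r" and K_pos: "0 < K" and n_pos: "0 < n"
    and p_in: "p \<in> Y" "p \<in> V" and X_ball: "\<And>z. z \<in> V \<Longrightarrow> coord1 p e v z \<in> ball 0 r"
    and size_A: "\<And>x. x \<in> ball 0 r \<Longrightarrow> size (A x) = n"
    and A_in: "\<And>x a. x \<in> ball 0 r \<Longrightarrow> a \<in># A x \<Longrightarrow> frame_pt p e v (x, a) \<in> Y"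
    and A_le: "\<And>x a. x \<in> ball 0 r \<Longrightarrow> a \<in># A x \<Longrightarrow> cmod a \<le> K * cmod x"
    and hol_m: "m holomorphic_on ball 0 r"
    and m_le: "\<And>x. x \<in> ball 0 r \<Longrightarrow> cmod (m x) \<le> K * cmod x"
    and mean: "\<And>x. x \<in> ball 0 r \<Longrightarrow> (\<Sum>a\<in>#A x. a - m x) = 0"
    and hol_c: "\<And>k. c k holomorphic_on ball 0 r"
    and c_0: "\<And>x. c 0 x = 1" and c_1: "\<And>x. x \<in> ball 0 r \<Longrightarrow> c 1 x = 0"
    and c_le: "\<And>x k \<rho>. x \<in> ball 0 r \<Longrightarrow> 0 \<le> \<rho> \<Longrightarrow> (\<And>a. a \<in># A x \<Longrightarrow> cmod (a - m x) \<le> \<rho>)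
        \<Longrightarrow> cmod (c k x) \<le> 2 ^ n * \<rho> ^ k"
    and equation: "local_equation Y V
        (\<lambda>z. \<Sum>k\<le>n. c k (coord1 p e v z) * (coord2 p e v z - m (coord1 p e v z)) ^ (n - k))"
begin

abbreviation "X \<equiv> coord1 p e v"

definition "H z = coord2 p e v z - m (X z)"

definition "W z = (\<Sum>k\<le>n. c k (X z) * H z ^ (n - k))"

lemma equation_W: "local_equation Y V W"
  using equation unfolding W_def[abs_def] H_def .

lemma hol2_H: "hol2 V H"
  unfolding H_def[abs_def]
  by (intro hol2_diff hol2_coord hol2_compose[OF hol_m open_ball hol2_coord(1)]) (use X_ball in auto)

lemma hol2_coeff: "f holomorphic_on ball 0 r \<Longrightarrow> hol2 V (\<lambda>z. f (X z))"
  by (rule hol2_compose[OF _ open_ball hol2_coord(1)]) (use X_ball in auto)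

text \<open>The differentials of \<open>X\<close> and \<open>H\<close> are independent: \<open>H\<close> differs from the second coordinate by a
function of \<open>X\<close>, which does not change the determinant.\<close>

lemma H_pds:
  assumes "z \<in> V"
  shows "\<exists>h1 h2 x1 x2. has_pds H z h1 h2 \<and> has_pds X z x1 x2 \<and>
    x1 * h2 - x2 * h1 = 1 / (fst e * snd v - snd e * fst v)"
proof -
  let ?J = "fst e * snd v - snd e * fst v"
  have "(m has_field_derivative deriv m (X z)) (at (X z))"
    using holomorphic_derivI[OF hol_m open_ball X_ball[OF assms]] .
  from has_pds_diff[OF has_pds_coord(2) has_pds_compose[where h=m, OF this has_pds_coord(1)]]
  have "has_pds H z (- snd e / ?J - deriv m (X z) * (snd v / ?J)) (fst e / ?J - deriv m (X z) * (- fst v / ?J))"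
    unfolding H_def[abs_def] .
  moreover have "snd v / ?J * (fst e / ?J - deriv m (X z) * (- fst v / ?J))
      - (- fst v / ?J) * (- snd e / ?J - deriv m (X z) * (snd v / ?J)) = ?J / (?J * ?J)"
    by (simp add: algebra_simps add_divide_distrib diff_divide_distrib)
  moreover have "?J / (?J * ?J) = 1 / ?J" using J by simp
  ultimately show ?thesis using has_pds_coord(1)[of p e v z] by metis
qed

text \<open>The form \<open>(a dx + b dy) / W\<close> has residue \<open>H / X\<^sup>N\<close>, that is, \<open>X\<^sup>N (a dx + b dy) = H dW\<close> on \<open>Y\<close>. The
differential of \<open>W\<close> is \<open>P dX + Q dH\<close> with \<open>P = \<Sum> c\<^sub>k' H\<^sup>n\<^sup>-\<^sup>k\<close> and \<open>Q = \<Sum> (n - k) c\<^sub>k H\<^sup>n\<^sup>-\<^sup>k\<^sup>-\<^sup>1\<close>. By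
assumption \<open>P = X\<^sup>N \<tau>\<close>, and \<open>H Q - n W = - \<Sum> k c\<^sub>k H\<^sup>n\<^sup>-\<^sup>k = - X\<^sup>N \<Gamma>\<close>. Modulo \<open>W\<close> the form \<open>H dW\<close> is
therefore \<open>X\<^sup>N\<close> times the holomorphic form \<open>H \<tau> dX - \<Gamma> dH\<close>. The factor \<open>k\<close> makes the
first divisibility condition void for the leading coefficient \<open>c 0 = 1\<close>.\<close>

lemma polar_logarithmic_form:
  assumes hol: "\<And>k. \<gamma> k holomorphic_on ball 0 r" "\<And>k. \<delta> k holomorphic_on ball 0 r"
    and \<gamma>: "\<And>k x. k \<le> n \<Longrightarrow> x \<in> ball 0 r \<Longrightarrow> of_nat k * c k x = x ^ N * \<gamma> k x"
    and \<delta>: "\<And>k x. k \<le> n \<Longrightarrow> x \<in> ball 0 r \<Longrightarrow> deriv (c k) x = x ^ N * \<delta> k x"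
  obtains a b d where "hol2 V a" "hol2 V b" "hol2 V d"
    "\<And>z. z \<in> V \<Longrightarrow> pd1 W z * b z - pd2 W z * a z = W z * d z"
    "\<And>z. z \<in> Y \<inter> V \<Longrightarrow> X z ^ N * a z = H z * pd1 W z"
    "\<And>z. z \<in> Y \<inter> V \<Longrightarrow> X z ^ N * b z = H z * pd2 W z"
proof -
  note oV = local_equationD(1)[OF equation_W]
  let ?J = "fst e * snd v - snd e * fst v"
  define \<tau> where "\<tau> z = (\<Sum>k\<le>n. \<delta> k (X z) * H z ^ (n - k))" for z
  define \<Gamma> where "\<Gamma> z = (\<Sum>k\<le>n. \<gamma> k (X z) * H z ^ (n - k))" for z
  define a where "a z = H z * \<tau> z * pd1 X z - \<Gamma> z * pd1 H z" for z
  define b where "b z = H z * \<tau> z * pd2 X z - \<Gamma> z * pd2 H z" for z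
  define d where "d z = - of_nat n * \<tau> z * (1 / ?J)" for z
  have h\<tau>: "hol2 V \<tau>" and h\<Gamma>: "hol2 V \<Gamma>"
    unfolding \<tau>_def[abs_def] \<Gamma>_def[abs_def]
    by (intro hol2_sum hol2_mult hol2_power hol2_H hol2_coeff hol)+
  have 1: "hol2 V a" "hol2 V b" "hol2 V d"
    unfolding a_def[abs_def] b_def[abs_def] d_def[abs_def]
    by (intro hol2_diff hol2_mult hol2_H h\<tau> h\<Gamma> hol2_const hol2_pd1[OF oV] hol2_pd2[OF oV] hol2_coord)+
  have key: "pd1 W z * b z - pd2 W z * a z = W z * d z \<and>
      X z ^ N * a z = H z * pd1 W z - of_nat n * W z * pd1 H z \<and>
      X z ^ N * b z = H z * pd2 W z - of_nat n * W z * pd2 H z" if z: "z \<in> V" for z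
  proof -
    obtain h1 h2 x1 x2 where hx: "has_pds H z h1 h2" "has_pds X z x1 x2" "x1 * h2 - x2 * h1 = 1 / ?J"
      using H_pds[OF z] by blast
    define P where "P = (\<Sum>k\<le>n. deriv (c k) (X z) * H z ^ (n - k))"
    define Q where "Q = (\<Sum>k\<le>n. c k (X z) * (of_nat (n - k) * H z ^ (n - k - 1)))"
    have summand: "has_pds (\<lambda>z. c k (X z) * H z ^ (n - k)) z
        (deriv (c k) (X z) * x1 * H z ^ (n - k) + c k (X z) * (of_nat (n - k) * H z ^ (n - k - 1) * h1))
        (deriv (c k) (X z) * x2 * H z ^ (n - k) + c k (X z) * (of_nat (n - k) * H z ^ (n - k - 1) * h2))" for k
    proof (rule has_pds_mult)
      show "has_pds (\<lambda>z. c k (X z)) z (deriv (c k) (X z) * x1) (deriv (c k) (X z) * x2)"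
        by (rule has_pds_compose[where h="c k", OF holomorphic_derivI[OF hol_c open_ball X_ball[OF z]] hx(2)])
      have "((\<lambda>t. t ^ (n - k)) has_field_derivative of_nat (n - k) * H z ^ (n - k - 1)) (at (H z))"
        by (auto intro!: derivative_eq_intros)
      from has_pds_compose[where h="\<lambda>t. t ^ (n - k)", OF this hx(1)]
      show "has_pds (\<lambda>z. H z ^ (n - k)) z (of_nat (n - k) * H z ^ (n - k - 1) * h1)
          (of_nat (n - k) * H z ^ (n - k - 1) * h2)" .
    qed
    have "(\<Sum>k\<le>n. deriv (c k) (X z) * x * H z ^ (n - k)
        + c k (X z) * (of_nat (n - k) * H z ^ (n - k - 1) * h)) = P * x + Q * h" for x h
      unfolding P_def Q_def sum_distrib_right sum.distrib[symmetric]
      by (intro sum.cong refl) (simp add: algebra_simps)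
    with has_pds_sum[of "{..n}" "\<lambda>k z. c k (X z) * H z ^ (n - k)", OF summand]
    have "has_pds W z (P * x1 + Q * h1) (P * x2 + Q * h2)"
      unfolding W_def[abs_def] by simp
    note Wp = has_pds_eq[OF this]
    have P: "P = X z ^ N * \<tau> z"
      unfolding P_def \<tau>_def sum_distrib_left
      by (rule sum.cong[OF refl]) (simp add: \<delta>[OF _ X_ball[OF z]])
    have Q: "H z * Q = of_nat n * W z - X z ^ N * \<Gamma> z"
      unfolding Q_def \<Gamma>_def W_def sum_distrib_left sum_subtractf[symmetric]
    proof (rule sum.cong[OF refl])
      fix k assume "k \<in> {..n}"
      then have k: "k \<le> n" by simp
      have "H z * (c k (X z) * (of_nat (n - k) * H z ^ (n - k - 1))) = of_nat (n - k) * (c k (X z) * H z ^ (n - k))"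
        by (cases "n - k") simp_all
      also have "\<dots> = of_nat n * (c k (X z) * H z ^ (n - k)) - (of_nat k * c k (X z)) * H z ^ (n - k)"
        using k by (simp add: of_nat_diff algebra_simps)
      finally show "H z * (c k (X z) * (of_nat (n - k) * H z ^ (n - k - 1)))
          = of_nat n * (c k (X z) * H z ^ (n - k)) - X z ^ N * (\<gamma> k (X z) * H z ^ (n - k))"
        unfolding \<gamma>[OF k X_ball[OF z]] by simp
    qed
    have "(P * x1 + Q * h1) * (H z * \<tau> z * x2 - \<Gamma> z * h2) - (P * x2 + Q * h2) * (H z * \<tau> z * x1 - \<Gamma> z * h1)
        = - (P * \<Gamma> z + (H z * Q) * \<tau> z) * (x1 * h2 - x2 * h1)"
      by (simp add: algebra_simps)
    also have "\<dots> = W z * d z"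
      unfolding P Q hx(3) d_def by (simp add: algebra_simps)
    finally have 1: "pd1 W z * b z - pd2 W z * a z = W z * d z"
      unfolding Wp a_def b_def has_pds_eq[OF hx(1)] has_pds_eq[OF hx(2)] .
    have "X z ^ N * (H z * \<tau> z * x - \<Gamma> z * h) = H z * (P * x + Q * h) - of_nat n * W z * h" for x h
    proof -
      have "H z * (P * x + Q * h) - of_nat n * W z * h = H z * P * x + (H z * Q - of_nat n * W z) * h"
        by (simp add: algebra_simps)
      then show ?thesis unfolding P Q by (simp add: algebra_simps)
    qed
    then show ?thesis
      using 1 unfolding Wp a_def b_def has_pds_eq[OF hx(1)] has_pds_eq[OF hx(2)] by simp
  qed
  have "W z = 0" if "z \<in> Y \<inter> V" for z using local_equationD(3)[OF equation_W] that by blast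
  with key show thesis by (intro that[OF 1]) simp_all
qed

text \<open>The residue of the form above is \<open>H / X\<^sup>N\<close> at the nonsingular points of \<open>Y\<close>, and by density and
continuity everywhere. If \<open>X\<^sup>N\<^sup>+\<^sup>1\<close> divides \<open>c k\<close> then \<open>X\<^sup>N\<close> divides \<open>c k\<close> and its derivative.\<close>

lemma residue_is_quotient:
  assumes eq: "plane_weak_norm_eq_omega0 G Y" and int: "interior Y = {}" and "V \<subseteq> G" and "0 < N"
    and dvd: "\<And>k. k \<in> {1..n} \<Longrightarrow> \<exists>d. d holomorphic_on ball 0 r \<and> (\<forall>x\<in>ball 0 r. c k x = x ^ Suc N * d x)"
  obtains M \<phi> where "open M" "p \<in> M" "M \<subseteq> V" "continuous_on (Y \<inter> M) \<phi>"
    "\<And>q. q \<in> Y \<inter> M \<Longrightarrow> H q = X q ^ N * \<phi> q"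
proof -
  obtain d where d: "\<And>k. k \<in> {1..n} \<Longrightarrow> d k holomorphic_on ball 0 r"
    "\<And>k x. k \<in> {1..n} \<Longrightarrow> x \<in> ball 0 r \<Longrightarrow> c k x = x ^ Suc N * d k x"
    using dvd by metis
  define \<gamma> where "\<gamma> k = (if k \<in> {1..n} then \<lambda>x. of_nat k * (x * d k x) else (\<lambda>_. 0))" for k
  define \<delta> where "\<delta> k = (if k \<in> {1..n} then \<lambda>x. of_nat (Suc N) * d k x + x * deriv (d k) x else (\<lambda>_. 0))" for k
  obtain a b l where ab: "hol2 V a" "hol2 V b" "hol2 V l"
    "\<And>z. z \<in> V \<Longrightarrow> pd1 W z * b z - pd2 W z * a z = W z * l z"
    "\<And>z. z \<in> Y \<inter> V \<Longrightarrow> X z ^ N * a z = H z * pd1 W z"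
    "\<And>z. z \<in> Y \<inter> V \<Longrightarrow> X z ^ N * b z = H z * pd2 W z"
  proof (rule polar_logarithmic_form[of \<gamma> \<delta> N])
    show "\<gamma> k holomorphic_on ball 0 r" for k
      unfolding \<gamma>_def using d(1)[of k] by (auto intro!: holomorphic_intros)
    show "\<delta> k holomorphic_on ball 0 r" for k
      unfolding \<delta>_def using d(1)[of k] by (auto intro!: holomorphic_intros)
    show "of_nat k * c k x = x ^ N * \<gamma> k x" if "k \<le> n" "x \<in> ball 0 r" for k x
      using d(2)[of k x] that by (cases "k = 0") (simp_all add: \<gamma>_def)
    show "deriv (c k) x = x ^ N * \<delta> k x" if k: "k \<le> n" and x: "x \<in> ball 0 r" for k x
    proof (cases "k = 0")
      case True
      have "c 0 = (\<lambda>_. 1)" using c_0 by blast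
      then show ?thesis using True by (simp add: \<delta>_def)
    next
      case False
      then have k1: "k \<in> {1..n}" using k by simp
      have "(d k has_field_derivative deriv (d k) x) (at x)"
        by (rule holomorphic_derivI[OF d(1)[OF k1] open_ball x])
      from DERIV_mult[OF DERIV_power_Suc[OF DERIV_ident, of N] this]
      have "((\<lambda>x. x ^ Suc N * d k x) has_field_derivative
          (1 + of_nat N) * (1 * x ^ N) * d k x + deriv (d k) x * x ^ Suc N) (at x)" .
      moreover have "(1 + of_nat N) * (1 * x ^ N) * d k x + deriv (d k) x * x ^ Suc N = x ^ N * \<delta> k x"
        using k1 by (simp add: \<delta>_def algebra_simps)
      ultimately have "((\<lambda>x. x ^ Suc N * d k x) has_field_derivative x ^ N * \<delta> k x) (at x)" by simp
      then have "(c k has_field_derivative x ^ N * \<delta> k x) (at x)"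
        by (rule has_field_derivative_transform_within_open[OF _ open_ball x]) (simp add: d(2)[OF k1])
      then show ?thesis by (rule DERIV_imp_deriv)
    qed
  qed (rule that)
  obtain M \<phi> where M: "open M" "p \<in> M" "M \<subseteq> V" "continuous_on (Y \<inter> M) \<phi>"
    and res: "\<And>q. q \<in> Y \<inter> M \<Longrightarrow> pd1 W q \<noteq> 0 \<or> pd2 W q \<noteq> 0 \<Longrightarrow>
      a q = \<phi> q * pd1 W q \<and> b q = \<phi> q * pd2 W q"
    by (rule logarithmic_form_residue_continuous[OF eq int equation_W p_in \<open>V \<subseteq> G\<close> ab(1-4)])
      (assumption, rule that)
  have nonsing: "X q ^ N * \<phi> q - H q = 0" if q: "q \<in> Y \<inter> M" "pd1 W q \<noteq> 0 \<or> pd2 W q \<noteq> 0" for q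
  proof -
    have "q \<in> Y \<inter> V" using q(1) M(3) by blast
    from ab(5,6)[OF this] res[OF q]
    have "(X q ^ N * \<phi> q - H q) * pd1 W q = 0" "(X q ^ N * \<phi> q - H q) * pd2 W q = 0"
      by (simp_all add: left_diff_distrib)
    then show ?thesis using q(2) by auto
  qed
  have "X q ^ N * \<phi> q - H q = 0" if q: "q \<in> Y \<inter> M" for q
  proof (rule ccontr)
    assume nz: "X q ^ N * \<phi> q - H q \<noteq> 0"
    have "continuous_on (Y \<inter> M) (\<lambda>q. X q ^ N * \<phi> q - H q)"
      by (intro continuous_intros M(4) hol2_continuous_on[OF hol2_coord(1)]
          continuous_on_subset[OF hol2_continuous_on[OF hol2_H]]) (use M(3) in blast)
    then obtain O' where O': "open O'" "O' \<inter> (Y \<inter> M) = (\<lambda>q. X q ^ N * \<phi> q - H q) -` (- {0}) \<inter> (Y \<inter> M)"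
      unfolding continuous_on_open_invariant using open_Compl[OF closed_singleton] by blast
    have "open (O' \<inter> M)" "q \<in> O' \<inter> M" "q \<in> Y" "q \<in> V" using O' M(1,3) q nz by auto
    from nonsingular_points_dense[OF equation_W int this(3,4,1,2)]
    obtain u where "u \<in> Y \<inter> V \<inter> (O' \<inter> M)" "pd1 W u \<noteq> 0 \<or> pd2 W u \<noteq> 0" by blast
    with nonsing[of u] O'(2) show False by blast
  qed
  with M show thesis by (intro that) auto
qed

text \<open>All the points of \<open>Y\<close> over \<open>x\<close> tend to \<open>p\<close> as \<open>x\<close> tends to \<open>0\<close>.\<close>

lemma points_over_small_x:
  assumes "open M" "p \<in> M"
  obtains \<tau> where "0 < \<tau>" "\<tau> \<le> r"
    "\<And>x a. cmod x < \<tau> \<Longrightarrow> a \<in># A x \<Longrightarrow> frame_pt p e v (x, a) \<in> Y \<inter> M"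
proof -
  obtain \<rho> where \<rho>: "0 < \<rho>" "ball p \<rho> \<subseteq> M" using assms open_contains_ball by metis
  define L where "L = norm e + K * norm v + 1"
  have L: "0 < L" using K_pos by (auto simp: L_def intro!: add_nonneg_pos)
  show thesis
  proof (rule that[of "min r (\<rho> / L)"])
    fix x a assume x: "cmod x < min r (\<rho> / L)" and a: "a \<in># A x"
    then have xr: "x \<in> ball 0 r" by simp
    have "dist p (frame_pt p e v (x, a)) \<le> cmod x * norm e + cmod a * norm v"
      using dist_frame_pt[of p e v "(x, a)"] by simp
    also have "\<dots> \<le> cmod x * norm e + (K * cmod x) * norm v"
      by (intro add_left_mono mult_right_mono A_le[OF xr a]) simp
    also have "\<dots> \<le> cmod x * L" by (simp add: L_def algebra_simps)
    also have "\<dots> < \<rho>" using x L by (simp add: field_simps)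
    finally show "frame_pt p e v (x, a) \<in> Y \<inter> M" using \<rho>(2) A_in[OF xr a] by auto
  qed (use r_pos \<rho>(1) L in auto)
qed

text \<open>By continuity of the residue the \<open>n\<close> quotients \<open>(a - m x) / x\<^sup>N\<close> have a common limit. It is \<open>0\<close>
because they sum up to zero.\<close>

lemma roots_small_order:
  assumes eq: "plane_weak_norm_eq_omega0 G Y" and int: "interior Y = {}" and "V \<subseteq> G" and "0 < N"
    and dvd: "\<And>k. k \<in> {1..n} \<Longrightarrow> \<exists>d. d holomorphic_on ball 0 r \<and> (\<forall>x\<in>ball 0 r. c k x = x ^ Suc N * d x)"
    and "0 < \<epsilon>"
  shows "\<exists>\<tau>>0. \<forall>x. cmod x < \<tau> \<longrightarrow> (\<forall>a\<in>#A x. cmod (a - m x) \<le> \<epsilon> * cmod x ^ N)"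
proof -
  obtain M \<phi> where M: "open M" "p \<in> M" "M \<subseteq> V" "continuous_on (Y \<inter> M) \<phi>"
    "\<And>q. q \<in> Y \<inter> M \<Longrightarrow> H q = X q ^ N * \<phi> q"
    by (rule residue_is_quotient[OF eq int assms(3,4) dvd]) (assumption, rule that)
  have near: "\<exists>\<tau>>0. \<tau> \<le> r \<and> (\<forall>x. cmod x < \<tau> \<longrightarrow> (\<forall>a\<in>#A x. cmod (a - m x - x ^ N * \<phi> p) \<le> \<eta> * cmod x ^ N))"
    if \<eta>: "0 < \<eta>" for \<eta>
  proof -
    obtain s where s: "0 < s" "\<And>q. q \<in> Y \<inter> M \<Longrightarrow> dist q p < s \<Longrightarrow> dist (\<phi> q) (\<phi> p) < \<eta>"
      using M(2,4) p_in(1) \<eta> unfolding continuous_on_iff by (metis IntI)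
    have "open (M \<inter> ball p s)" "p \<in> M \<inter> ball p s" using M(1,2) s(1) by auto
    then obtain \<tau> where \<tau>: "0 < \<tau>" "\<tau> \<le> r"
      "\<And>x a. cmod x < \<tau> \<Longrightarrow> a \<in># A x \<Longrightarrow> frame_pt p e v (x, a) \<in> Y \<inter> (M \<inter> ball p s)"
      by (rule points_over_small_x) (rule that)
    have "cmod (a - m x - x ^ N * \<phi> p) \<le> \<eta> * cmod x ^ N" if x: "cmod x < \<tau>" and a: "a \<in># A x" for x a
    proof -
      let ?q = "frame_pt p e v (x, a)"
      have q: "?q \<in> Y \<inter> M" "dist ?q p < s" using \<tau>(3)[OF x a] by (auto simp: dist_commute)
      have "a - m x = x ^ N * \<phi> ?q"
        using M(5)[OF q(1)] coord_frame_pt[OF J] by (simp add: H_def)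
      then have "cmod (a - m x - x ^ N * \<phi> p) = cmod x ^ N * dist (\<phi> ?q) (\<phi> p)"
        by (simp add: dist_norm norm_mult norm_power flip: right_diff_distrib)
      also have "\<dots> \<le> cmod x ^ N * \<eta>"
        using s(2)[OF q] by (intro mult_left_mono) auto
      finally show ?thesis by (simp add: mult.commute)
    qed
    with \<tau> show ?thesis by blast
  qed
  have "\<phi> p = 0"
  proof (rule ccontr)
    assume nz: "\<phi> p \<noteq> 0"
    obtain \<tau> where \<tau>: "0 < \<tau>" "\<tau> \<le> r"
      "\<And>x a. cmod x < \<tau> \<Longrightarrow> a \<in># A x \<Longrightarrow> cmod (a - m x - x ^ N * \<phi> p) \<le> cmod (\<phi> p) / 2 * cmod x ^ N"
      using near[of "cmod (\<phi> p) / 2"] nz by auto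
    define x :: complex where "x = of_real (\<tau> / 2)"
    have nx: "cmod x = \<tau> / 2" using \<tau>(1) unfolding x_def norm_of_real by simp
    have x: "cmod x < \<tau>" "x \<in> ball 0 r" "0 < cmod x" using \<tau> nx by auto
    have "cmod (x ^ N * \<phi> p) \<le> cmod (\<phi> p) / 2 * cmod x ^ N"
      by (rule centred_mset_shift_le[OF mean[OF x(2)] \<tau>(3)[OF x(1)]])
        (use size_A[OF x(2)] n_pos in auto)
    then have "cmod (\<phi> p) * cmod x ^ N \<le> cmod (\<phi> p) / 2 * cmod x ^ N"
      by (simp add: norm_mult norm_power mult.commute)
    then have "cmod (\<phi> p) \<le> cmod (\<phi> p) / 2"
      by (rule mult_right_le_imp_le) (use x(3) in simp)
    then show False using nz by simp
  qed
  with near[OF \<open>0 < \<epsilon>\<close>] show ?thesis by auto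
qed

text \<open>Induction, with the bound \<open>\<bar>c k x\<bar> \<le> C \<bar>x\<bar>\<^sup>k\<close> of the tangent cone as the start. If \<open>x\<^sup>j\<^sup>+\<^sup>1\<close> divides
the coefficients, \<open>j \<ge> 1\<close>, then the differences \<open>a - m x\<close> are \<open>o(x\<^sup>j)\<close>. For \<open>k \<ge> 2\<close> the
coefficient is thus \<open>o(x\<^sup>2\<^sup>j)\<close>, and \<open>2 j \<ge> j + 1\<close>. The coefficient \<open>c 1\<close> is zero by the choice of
the mean.\<close>

lemma coefficient_order:
  assumes eq: "plane_weak_norm_eq_omega0 G Y" and int: "interior Y = {}" and "V \<subseteq> G"
    and "k \<in> {1..n}"
  shows "\<exists>d. d holomorphic_on ball 0 r \<and> (\<forall>x\<in>ball 0 r. c k x = x ^ Suc (Suc N) * d x)"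
  using \<open>k \<in> {1..n}\<close>
proof (induction N arbitrary: k)
  case 0
  then have k: "1 \<le> k" by simp
  have zero: "\<exists>d. d holomorphic_on ball 0 r \<and> (\<forall>x\<in>ball 0 r. c 1 x = x ^ j * d x)" for j
    by (rule exI[of _ "\<lambda>_. 0"]) (simp add: c_1 del: One_nat_def)
  have bound: "cmod (c k x) \<le> (2 ^ n * (2 * K) ^ k) * cmod x ^ k" if x: "x \<in> ball 0 r" for x
  proof -
    have "cmod (c k x) \<le> 2 ^ n * (2 * K * cmod x) ^ k"
    proof (rule c_le[OF x])
      fix a assume "a \<in># A x"
      have "cmod (a - m x) \<le> cmod a + cmod (m x)" by (rule norm_triangle_ineq4)
      also have "\<dots> \<le> 2 * K * cmod x" using A_le[OF x \<open>a \<in># A x\<close>] m_le[OF x] by simp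
      finally show "cmod (a - m x) \<le> 2 * K * cmod x" .
    qed (use K_pos in simp)
    then show ?thesis by (simp add: power_mult_distrib mult.assoc)
  qed
  have small: "\<exists>\<tau>>0. \<forall>x\<in>ball 0 r. cmod x < \<tau> \<longrightarrow> cmod (c k x) \<le> 2 ^ n * (2 * K) ^ k * \<epsilon> * cmod x ^ j"
    if "j < k" and \<epsilon>: "0 < \<epsilon>" "\<epsilon> \<le> 1" for j \<epsilon>
  proof (intro exI[of _ \<epsilon>] conjI ballI impI)
    fix x :: complex assume x: "x \<in> ball 0 r" "cmod x < \<epsilon>"
    have "cmod x ^ k \<le> cmod x ^ Suc j" using that x by (intro power_decreasing) auto
    also have "\<dots> \<le> \<epsilon> * cmod x ^ j" using x by (simp add: mult_right_mono)
    finally have "(2 ^ n * (2 * K) ^ k) * cmod x ^ k \<le> (2 ^ n * (2 * K) ^ k) * (\<epsilon> * cmod x ^ j)"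
      using K_pos by (intro mult_left_mono) auto
    from order_trans[OF bound[OF x(1)] this]
    show "cmod (c k x) \<le> 2 ^ n * (2 * K) ^ k * \<epsilon> * cmod x ^ j"
      by (simp only: mult.assoc)
  qed (use \<epsilon> in simp)
  show ?case
  proof (cases "k = 1")
    case True
    show ?thesis unfolding True by (rule zero)
  next
    case False
    obtain d where d: "d holomorphic_on ball 0 r" "\<And>x. x \<in> ball 0 r \<Longrightarrow> c k x = x ^ Suc 0 * d x"
      using holomorphic_order_gain[OF r_pos hol_c[of k], of "c k" 0, OF _ small] k by auto
    show ?thesis
      by (rule holomorphic_order_gain[OF r_pos d small]) (use False k in auto)
  qed
next
  case (Suc N)
  obtain d where d: "d holomorphic_on ball 0 r" "\<And>x. x \<in> ball 0 r \<Longrightarrow> c k x = x ^ Suc (Suc N) * d x"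
    using Suc by blast
  show ?case
  proof (cases "k = 1")
    case True
    have "\<forall>x\<in>ball 0 r. c 1 x = x ^ Suc (Suc (Suc N)) * 0" using c_1 by simp
    then show ?thesis using True by (intro exI[of _ "\<lambda>_. 0"]) simp
  next
    case False
    show ?thesis
    proof (rule holomorphic_order_gain[OF r_pos d])
      fix \<epsilon> :: real assume \<epsilon>: "0 < \<epsilon>" "\<epsilon> \<le> 1"
      obtain \<tau> where \<tau>: "0 < \<tau>" "\<And>x a. cmod x < \<tau> \<Longrightarrow> a \<in># A x \<Longrightarrow> cmod (a - m x) \<le> \<epsilon> * cmod x ^ Suc N"
        using roots_small_order[OF eq int \<open>V \<subseteq> G\<close> zero_less_Suc Suc.IH \<epsilon>(1)] by blast
      show "\<exists>\<tau>>0. \<forall>x\<in>ball 0 r. cmod x < \<tau> \<longrightarrow> cmod (c k x) \<le> 2 ^ n * \<epsilon> * cmod x ^ Suc (Suc N)"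
      proof (intro exI[of _ "min 1 \<tau>"] conjI ballI impI)
        fix x assume x: "x \<in> ball 0 r" "cmod x < min 1 \<tau>"
        have nonneg: "0 \<le> \<epsilon> * cmod x ^ Suc N" using \<epsilon> by simp
        have le1: "\<epsilon> * cmod x ^ Suc N \<le> 1"
          using \<epsilon> x by (intro mult_le_one power_le_one) auto
        have "cmod (c k x) \<le> 2 ^ n * (\<epsilon> * cmod x ^ Suc N) ^ k"
          by (rule c_le[OF x(1) nonneg]) (use \<tau>(2) x in auto)
        also have "\<dots> \<le> 2 ^ n * (\<epsilon> * cmod x ^ Suc N) ^ 2"
          using False Suc.prems by (intro mult_left_mono power_decreasing nonneg le1) auto
        also have "(\<epsilon> * cmod x ^ Suc N) ^ 2 = \<epsilon> ^ 2 * cmod x ^ (Suc N * 2)"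
          by (simp only: power_mult_distrib power_mult)
        also have "2 ^ n * (\<epsilon> ^ 2 * cmod x ^ (Suc N * 2)) \<le> 2 ^ n * (\<epsilon> ^ 1 * cmod x ^ Suc (Suc N))"
          using \<epsilon> x by (intro mult_left_mono mult_mono power_decreasing) auto
        finally show "cmod (c k x) \<le> 2 ^ n * \<epsilon> * cmod x ^ Suc (Suc N)"
          by (simp only: mult.assoc power_one_right)
      qed (use \<tau> in simp)
    qed
  qed
qed

text \<open>All lower coefficients are flat at \<open>0\<close>, hence zero, and the equation of \<open>Y\<close> is a power of \<open>H\<close>.\<close>

lemma centre_regular:
  assumes eq: "plane_weak_norm_eq_omega0 G Y" and int: "interior Y = {}" and "V \<subseteq> G"
  shows "p \<in> regular_locus Y"
proof -
  have c_zero: "c k x = 0" if k: "k \<in> {1..n}" and x: "x \<in> ball 0 r" for k x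
  proof (rule holomorphic_flat_zero[OF _ x])
    fix j
    obtain d where d: "d holomorphic_on ball 0 r" "\<And>x. x \<in> ball 0 r \<Longrightarrow> c k x = x ^ Suc (Suc j) * d x"
      using coefficient_order[OF assms k, of j] by blast
    have "(\<lambda>x. x ^ 2 * d x) holomorphic_on ball 0 r" by (intro holomorphic_intros d)
    moreover have "\<forall>x\<in>ball 0 r. c k x = x ^ j * (x ^ 2 * d x)"
      using d(2) by (simp add: power2_eq_square)
    ultimately show "\<exists>g. g holomorphic_on ball 0 r \<and> (\<forall>x\<in>ball 0 r. c k x = x ^ j * g x)" by blast
  qed
  have W: "W z = H z ^ n" if "z \<in> V" for z
  proof -
    have "W z = (\<Sum>k\<le>n. if k = 0 then H z ^ n else 0)"
      unfolding W_def
      by (rule sum.cong[OF refl]) (use c_zero X_ball[OF that] in \<open>auto simp: c_0\<close>)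
    then show ?thesis by simp
  qed
  note E = local_equationD[OF equation_W]
  have zeros: "Y \<inter> V = {z \<in> V. H z = 0}" unfolding E(3) using W n_pos by auto
  obtain h1 h2 x1 x2 where h: "has_pds H p h1 h2"
    "x1 * h2 - x2 * h1 = 1 / (fst e * snd v - snd e * fst v)"
    using H_pds[OF p_in(2)] by blast
  have "h1 \<noteq> 0 \<or> h2 \<noteq> 0" using h(2) J by auto
  then have "pd1 H p \<noteq> 0 \<or> pd2 H p \<noteq> 0" using has_pds_eq[OF h(1)] by simp
  then show ?thesis
    unfolding regular_locus_def using p_in E(1) hol2_H zeros by blast
qed

end

text \<open>The Weierstrass polynomial \<open>W\<close> vanishes on \<open>Y\<close>, so \<open>W = f h\<close> by reducedness. On the vertical axis
both \<open>W\<close> and \<open>f\<close> have order exactly \<open>n\<close>; therefore \<open>h\<close> is a unit at \<open>p\<close>, and \<open>W\<close> is a local equation.\<close>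

lemma weierstrass_chart_exists:
  assumes f: "local_equation Y U f" and int: "interior Y = {}" and p: "p \<in> Y" "p \<in> U"
  obtains V e v r K n A m c where "weierstrass_chart Y V p e v r K n A m c" "V \<subseteq> U"
proof -
  note U = local_equationD[OF f]
  have fp: "f p = 0" using U(3) p by blast
  have nz: "\<exists>z\<in>N. f z \<noteq> 0" if N: "open N" "p \<in> N" for N
  proof (rule ccontr)
    assume "\<not> ?thesis"
    then have "U \<inter> N \<subseteq> Y" using U(3) by blast
    then have "U \<inter> N \<subseteq> interior Y" using U(1) N(1) by (intro interior_maximal) auto
    then show False using int p(2) N(2) by blast
  qed
  obtain e v r R K n g where J: "fst e * snd v - snd e * fst v \<noteq> 0"
    and rR: "0 < r" "0 < R" "0 < K" "K * r < R"
    and sub: "frame_pt p e v ` (ball 0 r \<times> ball 0 R) \<subseteq> U"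
    and cone: "\<And>x y. y \<in> ball 0 R \<Longrightarrow> f (frame_pt p e v (x, y)) = 0 \<Longrightarrow> cmod y \<le> K * cmod x"
    and g: "g holomorphic_on ball 0 R" "\<And>y. y \<in> ball 0 R \<Longrightarrow> g y \<noteq> 0"
      "\<And>y. y \<in> ball 0 R \<Longrightarrow> f (frame_pt p e v (0, y)) = y ^ n * g y"
    by (rule tangent_cone_coordinates[OF U(1) p(2) U(2) fp nz]) (assumption+, rule that)
  obtain A m c where A: "\<And>x. x \<in> ball 0 r \<Longrightarrow> size (A x) = n"
    "\<And>x. x \<in> ball 0 r \<Longrightarrow> set_mset (A x) = {y \<in> ball 0 R. f (frame_pt p e v (x, y)) = 0}"
    and hm: "m holomorphic_on ball 0 r"
    and prod: "\<And>x y. x \<in> ball 0 r \<Longrightarrow> (\<Prod>a\<in>#A x. y - a) = (\<Sum>k\<le>n. c k x * (y - m x) ^ (n - k))"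
    and m: "\<And>x. x \<in> ball 0 r \<Longrightarrow> (\<Sum>a\<in>#A x. a - m x) = 0"
    "\<And>x. x \<in> ball 0 r \<Longrightarrow> cmod (m x) \<le> K * cmod x"
    and c: "\<And>k. c k holomorphic_on ball 0 r" "\<And>x. c 0 x = 1" "\<And>x. x \<in> ball 0 r \<Longrightarrow> c 1 x = 0"
    and c_le: "\<And>x k \<rho>. x \<in> ball 0 r \<Longrightarrow> 0 \<le> \<rho> \<Longrightarrow> \<forall>a\<in>#A x. cmod (a - m x) \<le> \<rho>
        \<Longrightarrow> cmod (c k x) \<le> 2 ^ n * \<rho> ^ k"
    by (rule weierstrass_polynomial[OF hol2_compose_frame_pt[OF U(2) sub] rR cone g]) (assumption+, rule that)
  define V0 where "V0 = U \<inter> (coord1 p e v -` ball 0 r \<inter> coord2 p e v -` ball 0 R)"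
  have "open V0"
    unfolding V0_def
    by (intro open_Int U(1) open_vimage open_ball hol2_continuous_on[OF hol2_coord(1)] hol2_continuous_on[OF hol2_coord(2)])
  have V0: "coord1 p e v z \<in> ball 0 r" "coord2 p e v z \<in> ball 0 R" if "z \<in> V0" for z
    using that by (auto simp: V0_def)
  define W where "W z = (\<Sum>k\<le>n. c k (coord1 p e v z) * (coord2 p e v z - m (coord1 p e v z)) ^ (n - k))" for z
  have hW: "hol2 V0 W"
    unfolding W_def[abs_def]
    by (intro hol2_sum hol2_mult hol2_power hol2_diff hol2_coord hol2_compose[OF hm open_ball hol2_coord(1)]
        hol2_compose[OF c(1) open_ball hol2_coord(1)]) (use V0 in auto)
  have W0: "W z = 0" if z: "z \<in> Y \<inter> V0" for z
  proof -
    have "f (frame_pt p e v (coord1 p e v z, coord2 p e v z)) = 0"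
      unfolding coord_frame_pt(3)[OF J] using U(3) z by (auto simp: V0_def)
    then have "coord2 p e v z \<in># A (coord1 p e v z)" using A(2) V0 z by auto
    then have "(\<Prod>a\<in>#A (coord1 p e v z). coord2 p e v z - a) = 0" by (auto simp: prod_mset_zero_iff)
    moreover have "W z = (\<Prod>a\<in>#A (coord1 p e v z). coord2 p e v z - a)"
      unfolding W_def by (rule prod[OF V0(1), symmetric]) (use z in blast)
    ultimately show ?thesis by (rule trans[rotated])
  qed
  obtain h where h: "hol2 V0 h" "\<And>z. z \<in> V0 \<Longrightarrow> W z = f z * h z"
    by (rule local_equation_factor[OF f \<open>open V0\<close> _ hW W0]) (auto simp: V0_def intro: that)
  have axis: "frame_pt p e v (0, y) \<in> V0" if "y \<in> ball 0 R" for y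
  proof -
    have "frame_pt p e v (0, y) \<in> U" using sub that rR(1) by force
    then show ?thesis using that rR(1) by (simp add: V0_def coord_frame_pt[OF J])
  qed
  have p_frame_pt: "frame_pt p e v (0, 0) = p" by (simp add: frame_pt_def)
  have pV0: "p \<in> V0" using axis[of 0] rR(2) p_frame_pt by simp
  \<comment> \<open>On the vertical axis \<open>W = y\<^sup>n\<close> and \<open>f = y\<^sup>n g(y)\<close>; divide by \<open>y\<^sup>n\<close> and let \<open>y\<close> tend to \<open>0\<close>.\<close>
  have "g 0 * h p = 1"
  proof (rule tendsto_unique[OF trivial_limit_at])
    have "continuous_on (ball 0 R) (\<lambda>y. g y * h (frame_pt p e v (0, y)))"
      by (intro continuous_intros holomorphic_on_imp_continuous_on[OF g(1)]
          continuous_on_compose2[OF hol2_continuous_on[OF h(1)]] continuous_on_compose2[OF continuous_on_frame_pt[of UNIV]])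
        (use axis in auto)
    then have "isCont (\<lambda>y. g y * h (frame_pt p e v (0, y))) 0"
      using rR(2) by (simp add: continuous_on_eq_continuous_at)
    then show "((\<lambda>y. g y * h (frame_pt p e v (0, y))) \<longlongrightarrow> g 0 * h p) (at 0)"
      by (simp add: isCont_def p_frame_pt)
    have "1 = g y * h (frame_pt p e v (0, y))" if y: "y \<in> ball 0 R" "y \<noteq> 0" for y
    proof -
      have zero: "a = 0" if "a \<in># A 0" for a
        using A(2)[of 0] cone[of a 0] that rR(1) by auto
      have "(\<Prod>a\<in>#M. y - a) = y ^ size M" if "\<And>a. a \<in># M \<Longrightarrow> a = 0" for M
        using that by (induction M) auto
      from this[OF zero] have "(\<Prod>a\<in>#A 0. y - a) = y ^ n" using A(1)[of 0] rR(1) by simp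
      then have "W (frame_pt p e v (0, y)) = y ^ n"
        using prod[of 0 y] rR(1) by (simp add: W_def coord_frame_pt[OF J])
      then have "y ^ n * (g y * h (frame_pt p e v (0, y))) = y ^ n * 1"
        using h(2)[OF axis[OF y(1)]] g(3)[OF y(1)] by simp
      then show ?thesis using y(2) by simp
    qed
    then have "eventually (\<lambda>y. 1 = g y * h (frame_pt p e v (0, y))) (at 0)"
      unfolding eventually_at using rR(2) by (intro exI[of _ R]) (auto simp: dist_commute)
    then show "((\<lambda>y. g y * h (frame_pt p e v (0, y))) \<longlongrightarrow> 1) (at 0)"
      by (rule Lim_transform_eventually[OF tendsto_const])
  qed
  then have hp: "h p \<noteq> 0" by auto
  define V where "V = V0 \<inter> h -` (- {0})"
  have oV: "open V"
    unfolding V_def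
    by (rule continuous_open_preimage[OF hol2_continuous_on[OF h(1)] \<open>open V0\<close> open_Compl[OF closed_singleton]])
  have VV: "V \<subseteq> V0" "V \<subseteq> U" by (auto simp: V_def V0_def)
  have eq: "local_equation Y V W"
    by (rule local_equation_times_unit[OF local_equation_subset[OF f oV VV(2)] hol2_subset[OF h(1) VV(1)]])
      (use h(2) in \<open>auto simp: V_def\<close>)
  have chart: "weierstrass_chart Y V p e v r K n A m c"
  proof (rule weierstrass_chart.intro)
    show "0 < n"
    proof (rule ccontr)
      assume "\<not> 0 < n"
      then show False using g(2,3)[of 0] rR(2) fp p_frame_pt by simp
    qed
    show "p \<in> V" using pV0 hp by (simp add: V_def)
    show "frame_pt p e v (x, a) \<in> Y" "cmod a \<le> K * cmod x" if "x \<in> ball 0 r" "a \<in># A x" for x a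
    proof -
      have a: "a \<in> ball 0 R" "f (frame_pt p e v (x, a)) = 0" using A(2) that by auto
      then have "frame_pt p e v (x, a) \<in> U" using sub that(1) by blast
      then show "frame_pt p e v (x, a) \<in> Y" using U(3) a(2) by blast
      show "cmod a \<le> K * cmod x" by (rule cone[OF a])
    qed
    show "local_equation Y V (\<lambda>z. \<Sum>k\<le>n. c k (coord1 p e v z) * (coord2 p e v z - m (coord1 p e v z)) ^ (n - k))"
      using eq unfolding W_def[abs_def] .
    show "coord1 p e v z \<in> ball 0 r" if "z \<in> V" for z using V0(1) VV(1) that by blast
    show "cmod (c k x) \<le> 2 ^ n * \<rho> ^ k"
      if "x \<in> ball 0 r" "0 \<le> \<rho>" "\<And>a. a \<in># A x \<Longrightarrow> cmod (a - m x) \<le> \<rho>" for x k \<rho>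
      by (rule c_le[OF that(1,2)]) (use that(3) in blast)
  qed (fact J rR p A hm m c)+
  show thesis by (rule that[OF chart VV(2)])
qed

section \<open>Smoothness\<close>

lemma plane_curve_smooth:
  assumes Y: "plane_curve G Y" and eq: "plane_weak_norm_eq_omega0 G Y"
  shows "regular_locus Y = Y"
proof
  show "regular_locus Y \<subseteq> Y" unfolding regular_locus_def by blast
  show "Y \<subseteq> regular_locus Y"
  proof
    fix p assume p: "p \<in> Y"
    have int: "interior Y = {}" and "p \<in> G" using Y p unfolding plane_curve_def by blast+
    then obtain U f where U: "p \<in> U" "U \<subseteq> G" "local_equation Y U f"
      using Y unfolding plane_curve_def by meson
    obtain V e v r K n A m c where chart: "weierstrass_chart Y V p e v r K n A m c" and V: "V \<subseteq> U"
      by (rule weierstrass_chart_exists[OF U(3) int p U(1)])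
    show "p \<in> regular_locus Y"
      by (rule weierstrass_chart.centre_regular[OF chart eq int subset_trans[OF V U(2)]])
  qed
qed

theorem theorem7:
  fixes P :: "'a::t2_space set" and A :: "'a chart set" and X :: "'a set"
  assumes "complex_surface P A"
    and "reduced_curve P A X"
    and "weak_norm_eq_omega0 A X"
  shows "smooth_curve A X"
  unfolding smooth_curve_def
proof (intro ballI, clarify)
  fix D \<phi> assume "(D, \<phi>) \<in> A"
  then have "plane_curve (\<phi> ` D) (\<phi> ` (X \<inter> D))" "plane_weak_norm_eq_omega0 (\<phi> ` D) (\<phi> ` (X \<inter> D))"
    using assms(2,3) unfolding reduced_curve_def weak_norm_eq_omega0_def by blast+
  then show "regular_locus (\<phi> ` (X \<inter> D)) = \<phi> ` (X \<inter> D)" by (rule plane_curve_smooth)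
qed

end
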